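(* Let $G$ be a Cameron--Walker graph whose bipartite part is the complete bipartite graph $K_{n,m}$ ($n,m\ge1$), and let $J_G\subset T$ be the defining ideal of the Rees algebra of the vertex cover ideal $I_G$ of $G$, with the vertex names, the generators $u_1,\ldots,u_s$ of $I_G$, the polynomial ring $T$ and the monomial order $<$ on $T$ as defined in the context. Let $\mathcal W_G$ be the set consisting of the following monomials of $T$: (i) $\xi_iy_r$, where $\xi_i$ does not divide $u_r$; (ii) $\zeta_jy_r$, where $q_j>0$ and $\zeta_j$ does not divide $u_r$; (iii) $c_j^{(k)}y_r$, where $c_j^{(k)}$ does not divide $u_r$; (iv) $y_{r_0}y_{r_1}$ with $r_0>r_1$, such that for some $i$, $\xi_i$ does not divide $u_{r_0}$ and $\xi_i$ divides $u_{r_1}$; (v) $y_{r_0}y_{r_1}$ with $r_0>r_1$, such that for some $j$ and $k$, $\zeta_j$ divides both $u_{r_0}$ and $u_{r_1}$, $b_j^{(k)}$ divides $u_{r_0}$ and $c_j^{(k)}$ divides $u_{r_1}$; (vi) $y_{r_0}y_{r_1}$ with $r_0>r_1$, such that every $\xi_i$ ($1\le i\le n$) divides both $u_{r_0}$ and $u_{r_1}$ and for some $j$, $\zeta_j$ does not divide $u_{r_0}$ and $\zeta_j$ divides $u_{r_1}$. Then the minimal set of monomial generators of the initial ideal $\operatorname{in}_<(J_G)$ of $J_G$ with respect to $<$ is equal to $\mathcal W_G$. In particular, $\operatorname{in}_<(J_G)$ is generated by quadratic monomials.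
   Context: $G$ is the following graph. It contains the complete bipartite graph $K_{n,m}$ with vertex partition $\{\xi_1,\ldots,\xi_n\}\cup\{\zeta_1,\ldots,\zeta_m\}$, $n,m\ge1$. To each $\xi_i$ are attached leaf edges $\{\xi_i,a_i^{(1)}\},\ldots,\{\xi_i,a_i^{(p_i)}\}$ with $p_i\ge1$, and to each $\zeta_j$ are attached pendant triangles with vertex sets $\{\zeta_j,b_j^{(1)},c_j^{(1)}\},\ldots,\{\zeta_j,b_j^{(q_j)},c_j^{(q_j)}\}$ with $q_j\ge0$ (all the vertices $a_i^{(k)},b_j^{(k)},c_j^{(k)}$ are distinct). Let $S$ be the polynomial ring over a field $K$ whose variables are the vertices of $G$, and let $<_{\rm lex}$ be the pure lexicographic order on $S$ induced by $$a_1^{(1)}>\cdots>a_1^{(p_1)}>a_2^{(1)}>\cdots>a_2^{(p_2)}>\cdots>a_n^{(1)}>\cdots>a_n^{(p_n)}$$ $$>b_1^{(1)}>c_1^{(1)}>\cdots>b_1^{(q_1)}>c_1^{(q_1)}>\cdots>b_m^{(1)}>c_m^{(1)}>\cdots>b_m^{(q_m)}>c_m^{(q_m)}$$ $$>\zeta_1>\cdots>\zeta_m>\xi_1>\cdots>\xi_n.$$ The vertex cover ideal $I_G\subset S$ is generated by the monomials $\prod_{v\in C}v$, where $C$ ranges over the minimal vertex covers of $G$; let $u_1,\ldots,u_s$ be its minimal monomial generators, labeled so that $u_s<_{\rm lex}\cdots<_{\rm lex}u_2<_{\rm lex}u_1$. The Rees algebra $\mathcal R(I_G)\subset S[t]$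 is generated over $K$ by the variables of $S$ and $u_1t,\ldots,u_st$. Let $T=S[y_1,\ldots,y_s]$ (polynomial ring), and let $\pi:T\to\mathcal R(I_G)$ be the $K$-algebra homomorphism with $\pi(x)=x$ for each vertex $x$ of $G$ and $\pi(y_j)=u_jt$; $J_G=\operatorname{Ker}\pi$. Let $<_{\rm rev}$ be the (degree) reverse lexicographic order on $K[y_1,\ldots,y_s]$ induced by $y_1>y_2>\cdots>y_s$. The order $<$ on $T$: for monomials $v=v'v''$, $w=w'w''$ with $v',w'\in S$ and $v'',w''\in K[y_1,\ldots,y_s]$, $v<w$ iff $v''<_{\rm rev}w''$, or $v''=w''$ and $v'<_{\rm lex}w'$. *)

theory Defs
  imports "HOL-Library.Poly_Mapping" "HOL-Algebra.Generated_Rings"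
begin

section \<open>Monomials and polynomial rings\<close>

text \<open>
  A monomial is identified with its exponent vector, of type \<open>'v \<Rightarrow>\<^sub>0 nat\<close>; multiplication
  of monomials is addition of exponent vectors.  A polynomial with coefficients in the field \<open>'k\<close>
  is a finitely supported function on monomials.  The ring \<open>poly_ring X\<close> is the polynomial
  ring over \<open>'k\<close> in the indeterminates \<open>X\<close>, so \<open>poly_ring X\<close> is literally a subring of
  \<open>poly_ring Y\<close> whenever \<open>X \<subseteq> Y\<close>.
\<close>

definition monomials :: "'v set \<Rightarrow> ('v \<Rightarrow>\<^sub>0 nat) set"
  where "monomials X = {\<mu>. Poly_Mapping.keys \<mu> \<subseteq> X}"

definition poly_ring :: "'v set \<Rightarrow> (('v \<Rightarrow>\<^sub>0 nat) \<Rightarrow>\<^sub>0 'k::field) ring"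
  where "poly_ring X =
    \<lparr>carrier = {f. Poly_Mapping.keys f \<subseteq> monomials X}, mult = (*), one = 1, zero = 0, add = (+)\<rparr>"

definition var :: "'v \<Rightarrow> ('v \<Rightarrow>\<^sub>0 nat)"
  where "var x = Poly_Mapping.single x 1"

definition mdvd :: "('v \<Rightarrow>\<^sub>0 nat) \<Rightarrow> ('v \<Rightarrow>\<^sub>0 nat) \<Rightarrow> bool"  (infix \<open>mdvd\<close> 50)
  where "\<mu> mdvd \<nu> \<longleftrightarrow> (\<exists>\<kappa>. \<nu> = \<mu> + \<kappa>)"

definition mdeg :: "('v \<Rightarrow>\<^sub>0 nat) \<Rightarrow> nat"
  where "mdeg \<mu> = (\<Sum>x\<in>Poly_Mapping.keys \<mu>. Poly_Mapping.lookup \<mu> x)"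

definition mon :: "('v \<Rightarrow>\<^sub>0 nat) \<Rightarrow> (('v \<Rightarrow>\<^sub>0 nat) \<Rightarrow>\<^sub>0 'k::field)"
  where "mon \<mu> = Poly_Mapping.single \<mu> 1"

definition const :: "'k::field \<Rightarrow> (('v \<Rightarrow>\<^sub>0 nat) \<Rightarrow>\<^sub>0 'k)"
  where "const c = Poly_Mapping.single 0 c"

text \<open>The \<open>'k\<close>-algebra homomorphism that maps each indeterminate \<open>x\<close> to \<open>g x\<close>.\<close>

definition eval_hom ::
    "('v \<Rightarrow> (('w \<Rightarrow>\<^sub>0 nat) \<Rightarrow>\<^sub>0 'k::field)) \<Rightarrow> (('v \<Rightarrow>\<^sub>0 nat) \<Rightarrow>\<^sub>0 'k) \<Rightarrow> (('w \<Rightarrow>\<^sub>0 nat) \<Rightarrow>\<^sub>0 'k)"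
  where "eval_hom g f = (\<Sum>\<mu>\<in>Poly_Mapping.keys f. const (Poly_Mapping.lookup f \<mu>) *
           (\<Prod>x\<in>Poly_Mapping.keys \<mu>. g x ^ Poly_Mapping.lookup \<mu> x))"

text \<open>\<open>M\<close> is a minimal set of monomial generators of the ideal \<open>I\<close> of \<open>poly_ring X\<close>.\<close>

definition is_min_mon_gens ::
    "'v set \<Rightarrow> (('v \<Rightarrow>\<^sub>0 nat) \<Rightarrow>\<^sub>0 'k::field) set \<Rightarrow> ('v \<Rightarrow>\<^sub>0 nat) set \<Rightarrow> bool"
  where "is_min_mon_gens X I M \<longleftrightarrow>
    M \<subseteq> monomials X \<and> Idl\<^bsub>poly_ring X\<^esub> (mon ` M) = I \<and>
    (\<forall>N. N \<subset> M \<longrightarrow> Idl\<^bsub>poly_ring X\<^esub> (mon ` N) \<noteq> I)"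

section \<open>Monomial orders and initial ideals\<close>

text \<open>
  The strict orders below are induced by a list \<open>xs\<close> of the indeterminates in decreasing order,
  \<open>xs ! 0 > xs ! 1 > \<dots>\<close>; they are used only on monomials in the members of \<open>xs\<close>.
\<close>

definition lex_less :: "'v list \<Rightarrow> ('v \<Rightarrow>\<^sub>0 nat) \<Rightarrow> ('v \<Rightarrow>\<^sub>0 nat) \<Rightarrow> bool"
  where "lex_less xs \<mu> \<nu> \<longleftrightarrow>
    (\<exists>i<length xs. Poly_Mapping.lookup \<mu> (xs ! i) < Poly_Mapping.lookup \<nu> (xs ! i) \<and>
       (\<forall>j<i. Poly_Mapping.lookup \<mu> (xs ! j) = Poly_Mapping.lookup \<nu> (xs ! j)))"

definition revlex_less :: "'v list \<Rightarrow> ('v \<Rightarrow>\<^sub>0 nat) \<Rightarrow> ('v \<Rightarrow>\<^sub>0 nat) \<Rightarrow> bool"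
  where "revlex_less xs \<mu> \<nu> \<longleftrightarrow>
    mdeg \<mu> < mdeg \<nu> \<or>
    mdeg \<mu> = mdeg \<nu> \<and>
    (\<exists>i<length xs. Poly_Mapping.lookup \<nu> (xs ! i) < Poly_Mapping.lookup \<mu> (xs ! i) \<and>
       (\<forall>j. i < j \<and> j < length xs \<longrightarrow>
          Poly_Mapping.lookup \<mu> (xs ! j) = Poly_Mapping.lookup \<nu> (xs ! j)))"

text \<open>Here \<open>xs\<close> lists the indeterminates of \<open>S\<close> and \<open>ys\<close> those of \<open>K[y\<^sub>1, \<dots>, y\<^sub>s]\<close>.\<close>

definition prod_less :: "'v list \<Rightarrow> 'v list \<Rightarrow> ('v \<Rightarrow>\<^sub>0 nat) \<Rightarrow> ('v \<Rightarrow>\<^sub>0 nat) \<Rightarrow> bool"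
  where "prod_less xs ys v w \<longleftrightarrow>
    (\<exists>v' \<in> monomials (set xs). \<exists>v'' \<in> monomials (set ys).
     \<exists>w' \<in> monomials (set xs). \<exists>w'' \<in> monomials (set ys).
       v = v' + v'' \<and> w = w' + w'' \<and>
       (revlex_less ys v'' w'' \<or> v'' = w'' \<and> lex_less xs v' w'))"

definition is_initial_mon ::
    "(('v \<Rightarrow>\<^sub>0 nat) \<Rightarrow> ('v \<Rightarrow>\<^sub>0 nat) \<Rightarrow> bool) \<Rightarrow> (('v \<Rightarrow>\<^sub>0 nat) \<Rightarrow>\<^sub>0 'k::field) \<Rightarrow> ('v \<Rightarrow>\<^sub>0 nat) \<Rightarrow> bool"
  where "is_initial_mon lt f \<mu> \<longleftrightarrow>
    \<mu> \<in> Poly_Mapping.keys f \<and> (\<forall>\<nu>\<in>Poly_Mapping.keys f. \<nu> \<noteq> \<mu> \<longrightarrow> lt \<nu> \<mu>)"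

definition initial_ideal ::
    "'v set \<Rightarrow> (('v \<Rightarrow>\<^sub>0 nat) \<Rightarrow> ('v \<Rightarrow>\<^sub>0 nat) \<Rightarrow> bool) \<Rightarrow>
     (('v \<Rightarrow>\<^sub>0 nat) \<Rightarrow>\<^sub>0 'k::field) set \<Rightarrow> (('v \<Rightarrow>\<^sub>0 nat) \<Rightarrow>\<^sub>0 'k) set"
  where "initial_ideal X lt J =
    Idl\<^bsub>poly_ring X\<^esub> (mon ` {\<mu>. \<exists>f\<in>J. is_initial_mon lt f \<mu>})"

section \<open>Vertex cover ideals\<close>

text \<open>A simple graph is given by a vertex set \<open>V\<close> and a set \<open>E\<close> of two-element subsets of \<open>V\<close>.\<close>

definition vertex_cover :: "'v set \<Rightarrow> 'v set set \<Rightarrow> 'v set \<Rightarrow> bool"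
  where "vertex_cover V E C \<longleftrightarrow> C \<subseteq> V \<and> (\<forall>e\<in>E. e \<inter> C \<noteq> {})"

definition minimal_vertex_cover :: "'v set \<Rightarrow> 'v set set \<Rightarrow> 'v set \<Rightarrow> bool"
  where "minimal_vertex_cover V E C \<longleftrightarrow>
    vertex_cover V E C \<and> (\<forall>D. D \<subset> C \<longrightarrow> \<not> vertex_cover V E D)"

definition vertex_cover_ideal ::
    "'v set \<Rightarrow> 'v set set \<Rightarrow> (('v \<Rightarrow>\<^sub>0 nat) \<Rightarrow>\<^sub>0 'k::field) set"
  where "vertex_cover_ideal V E =
    Idl\<^bsub>poly_ring V\<^esub> {\<Prod>v\<in>C. mon (var v) | C. minimal_vertex_cover V E C}"

section \<open>The Cameron--Walker graph\<close>

text \<open>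
  All indeterminates: the vertices \<open>a\<^sub>i\<^sup>k\<close>, \<open>b\<^sub>j\<^sup>k\<close>, \<open>c\<^sub>j\<^sup>k\<close>, \<open>\<zeta>\<^sub>j\<close>, \<open>\<xi>\<^sub>i\<close> of the graph
  (written \<open>Av i k\<close>, \<open>Bv j k\<close>, \<open>Cv j k\<close>, \<open>Zeta j\<close>, \<open>Xi i\<close>), the \<open>y\<^sub>r\<close> (written \<open>Yv r\<close>), and
  the indeterminate \<open>t\<close> of \<open>S[t]\<close> (written \<open>Tv\<close>).  All indices start at \<open>1\<close>.
\<close>

datatype indet = Av nat nat | Bv nat nat | Cv nat nat | Zeta nat | Xi nat | Yv nat | Tv

definition cw_vertex_list ::
    "nat \<Rightarrow> nat \<Rightarrow> (nat \<Rightarrow> nat) \<Rightarrow> (nat \<Rightarrow> nat) \<Rightarrow> indet list"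
  where "cw_vertex_list n m p q =
    concat (map (\<lambda>i. map (\<lambda>k. Av i k) [1..<Suc (p i)]) [1..<Suc n]) @
    concat (map (\<lambda>j. concat (map (\<lambda>k. [Bv j k, Cv j k]) [1..<Suc (q j)])) [1..<Suc m]) @
    map Zeta [1..<Suc m] @ map Xi [1..<Suc n]"

definition cw_vertices :: "nat \<Rightarrow> nat \<Rightarrow> (nat \<Rightarrow> nat) \<Rightarrow> (nat \<Rightarrow> nat) \<Rightarrow> indet set"
  where "cw_vertices n m p q =
    {Av i k | i k. i \<in> {1..n} \<and> k \<in> {1..p i}} \<union>
    {Bv j k | j k. j \<in> {1..m} \<and> k \<in> {1..q j}} \<union>
    {Cv j k | j k. j \<in> {1..m} \<and> k \<in> {1..q j}} \<union>
    Zeta ` {1..m} \<union> Xi ` {1..n}"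

lemma set_cw_vertex_list: "set (cw_vertex_list n m p q) = cw_vertices n m p q"
proof (rule Set.set_eqI)
  fix x
  show "x \<in> set (cw_vertex_list n m p q) \<longleftrightarrow> x \<in> cw_vertices n m p q"
    unfolding cw_vertex_list_def cw_vertices_def set_append set_concat set_map set_upt image_image
      atLeastLessThanSuc_atLeastAtMost Un_iff UN_iff mem_Collect_eq
    by (cases x) (auto simp: image_iff)
qed

definition cw_edges :: "nat \<Rightarrow> nat \<Rightarrow> (nat \<Rightarrow> nat) \<Rightarrow> (nat \<Rightarrow> nat) \<Rightarrow> indet set set"
  where "cw_edges n m p q =
    {{Xi i, Zeta j} | i j. i \<in> {1..n} \<and> j \<in> {1..m}} \<union>
    {{Xi i, Av i k} | i k. i \<in> {1..n} \<and> k \<in> {1..p i}} \<union>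
    {{Zeta j, Bv j k} | j k. j \<in> {1..m} \<and> k \<in> {1..q j}} \<union>
    {{Zeta j, Cv j k} | j k. j \<in> {1..m} \<and> k \<in> {1..q j}} \<union>
    {{Bv j k, Cv j k} | j k. j \<in> {1..m} \<and> k \<in> {1..q j}}"

section \<open>The Rees algebra and its defining ideal\<close>

text \<open>
  In this section \<open>V\<close> is the set of indeterminates of \<open>S\<close>, and \<open>u 1, \<dots>, u s\<close> are the
  monomials generating the ideal of \<open>S\<close> whose Rees algebra is formed.
\<close>

definition rees_algebra ::
    "indet set \<Rightarrow> nat \<Rightarrow> (nat \<Rightarrow> (indet \<Rightarrow>\<^sub>0 nat)) \<Rightarrow> ((indet \<Rightarrow>\<^sub>0 nat) \<Rightarrow>\<^sub>0 'k::field) ring"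
  where "rees_algebra V s u = (poly_ring (V \<union> {Tv}))
    \<lparr>carrier := generate_ring (poly_ring (V \<union> {Tv}))
       (range const \<union> (\<lambda>x. mon (var x)) ` V \<union> (\<lambda>r. mon (u r) * mon (var Tv)) ` {1..s})\<rparr>"

definition rees_map ::
    "(nat \<Rightarrow> (indet \<Rightarrow>\<^sub>0 nat)) \<Rightarrow> ((indet \<Rightarrow>\<^sub>0 nat) \<Rightarrow>\<^sub>0 'k::field) \<Rightarrow> ((indet \<Rightarrow>\<^sub>0 nat) \<Rightarrow>\<^sub>0 'k)"
  where "rees_map u =
    eval_hom (\<lambda>x. case x of Yv r \<Rightarrow> mon (u r) * mon (var Tv) | _ \<Rightarrow> mon (var x))"

definition T_indets :: "indet set \<Rightarrow> nat \<Rightarrow> indet set"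
  where "T_indets V s = V \<union> Yv ` {1..s}"

definition rees_ideal ::
    "indet set \<Rightarrow> nat \<Rightarrow> (nat \<Rightarrow> (indet \<Rightarrow>\<^sub>0 nat)) \<Rightarrow> ((indet \<Rightarrow>\<^sub>0 nat) \<Rightarrow>\<^sub>0 'k::field) set"
  where "rees_ideal V s u =
    a_kernel (poly_ring (T_indets V s)) (rees_algebra V s u) (rees_map u)"

definition cw_T_less ::
    "nat \<Rightarrow> nat \<Rightarrow> (nat \<Rightarrow> nat) \<Rightarrow> (nat \<Rightarrow> nat) \<Rightarrow> nat \<Rightarrow>
     (indet \<Rightarrow>\<^sub>0 nat) \<Rightarrow> (indet \<Rightarrow>\<^sub>0 nat) \<Rightarrow> bool"
  where "cw_T_less n m p q s = prod_less (cw_vertex_list n m p q) (map Yv [1..<Suc s])"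

section \<open>The set of quadratic monomials\<close>

definition W_set ::
    "nat \<Rightarrow> nat \<Rightarrow> (nat \<Rightarrow> nat) \<Rightarrow> nat \<Rightarrow> (nat \<Rightarrow> (indet \<Rightarrow>\<^sub>0 nat)) \<Rightarrow> (indet \<Rightarrow>\<^sub>0 nat) set"
  where "W_set n m q s u =
    {var (Xi i) + var (Yv r) | i r. i \<in> {1..n} \<and> r \<in> {1..s} \<and> \<not> var (Xi i) mdvd u r} \<union>
    {var (Zeta j) + var (Yv r) | j r.
       j \<in> {1..m} \<and> r \<in> {1..s} \<and> q j > 0 \<and> \<not> var (Zeta j) mdvd u r} \<union>
    {var (Cv j k) + var (Yv r) | j k r.
       j \<in> {1..m} \<and> k \<in> {1..q j} \<and> r \<in> {1..s} \<and> \<not> var (Cv j k) mdvd u r} \<union>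
    {var (Yv r\<^sub>0) + var (Yv r\<^sub>1) | r\<^sub>0 r\<^sub>1.
       r\<^sub>0 \<in> {1..s} \<and> r\<^sub>1 \<in> {1..s} \<and> r\<^sub>0 > r\<^sub>1 \<and>
       (\<exists>i\<in>{1..n}. \<not> var (Xi i) mdvd u r\<^sub>0 \<and> var (Xi i) mdvd u r\<^sub>1)} \<union>
    {var (Yv r\<^sub>0) + var (Yv r\<^sub>1) | r\<^sub>0 r\<^sub>1.
       r\<^sub>0 \<in> {1..s} \<and> r\<^sub>1 \<in> {1..s} \<and> r\<^sub>0 > r\<^sub>1 \<and>
       (\<exists>j\<in>{1..m}. \<exists>k\<in>{1..q j}.
          var (Zeta j) mdvd u r\<^sub>0 \<and> var (Zeta j) mdvd u r\<^sub>1 \<and>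
          var (Bv j k) mdvd u r\<^sub>0 \<and> var (Cv j k) mdvd u r\<^sub>1)} \<union>
    {var (Yv r\<^sub>0) + var (Yv r\<^sub>1) | r\<^sub>0 r\<^sub>1.
       r\<^sub>0 \<in> {1..s} \<and> r\<^sub>1 \<in> {1..s} \<and> r\<^sub>0 > r\<^sub>1 \<and>
       (\<forall>i\<in>{1..n}. var (Xi i) mdvd u r\<^sub>0 \<and> var (Xi i) mdvd u r\<^sub>1) \<and>
       (\<exists>j\<in>{1..m}. \<not> var (Zeta j) mdvd u r\<^sub>0 \<and> var (Zeta j) mdvd u r\<^sub>1)}"

end

theory Submission
  imports Defs
begin

text \<open>
  Write \<open>C\<^sub>r\<close> for the minimal vertex cover whose monomial is \<open>u\<^sub>r\<close>, and \<open>W\<close> for the set of quadratic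
  monomials.  The coefficients of a member of the kernel of \<open>\<pi>\<close> sum to zero over the monomials with
  a given image.  Hence \<open>\<mu>\<close> is the initial monomial of some member exactly when a smaller
  monomial has the same image (\<open>initial_mons_rees_ideal\<close>).  It remains to show that the members of
  \<open>W\<close> have this property and that every \<open>\<mu>\<close> with it is a multiple of one.

  Both follow from the shape of the covers (\<open>minimal_vertex_cover_cw_iff\<close>).  A minimal cover is
  given by the set of absent \<open>\<xi>\<^sub>i\<close>, whose leaves are then present; by the set of present \<open>\<zeta>\<^sub>j\<close>,
  which is everything if some \<open>\<xi>\<^sub>i\<close> is absent, and otherwise any set of \<open>\<zeta>\<^sub>j\<close> with triangles; and by
  a choice between \<open>b\<close> and \<open>c\<close> in each triangle at a present \<open>\<zeta>\<^sub>j\<close>.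

  For a member of \<open>W\<close>, change one of these components in the cover of its only \<open>y\<close>-variable, or
  exchange it between the covers of its two \<open>y\<close>-variables.  The image is preserved up to vertices,
  which go into the \<open>S\<close>-part, and a new cover \<open>C\<^sub>a\<close> is lexicographically smaller than the old
  ones.  So \<open>a\<close> exceeds the old indices, and the new \<open>y\<close>-part is smaller in the reverse
  lexicographic order (\<open>W_set_nonminimal\<close>).

  Conversely, suppose that \<open>\<nu> < \<mu>\<close> have the same image and that no member of \<open>W\<close> divides \<open>\<mu>\<close>.
  After cancelling the common \<open>y\<close>-part, \<open>\<nu>\<close> contains some \<open>y\<^bsub>r'\<^esub>\<close> whose index exceeds the largest
  index \<open>l\<close> in \<open>\<mu>\<close>, so \<open>C\<^bsub>r'\<^esub>\<close> is lexicographically smaller than \<open>C\<^sub>l\<close>.  Since \<open>\<mu>\<close> avoids \<open>W\<close>, each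
  component varies monotonically along the indices of \<open>\<mu>\<close>, and \<open>\<mu>\<close> contains \<open>\<xi>\<^sub>i\<close>, \<open>c\<^sub>j\<^sup>k\<close> or a \<open>\<zeta>\<^sub>j\<close>
  with triangles only if all its covers do.  Consequently the exponents of the image
  determine what \<open>C\<^sub>l\<close> looks like, and the first vertex at which \<open>C\<^bsub>r'\<^esub>\<close> and \<open>C\<^sub>l\<close> differ gives
  a contradiction (\<open>W_free_no_smaller_preimage\<close>).

  Finally, monomials of degree two form an antichain for divisibility, and a monomial ideal
  generated by an antichain has no other minimal set of monomial generators
  (\<open>is_min_mon_gens_antichain_iff\<close>).
\<close>

section \<open>Monomial ideals\<close>

lemma carrier_poly_ring: "carrier (poly_ring X) = {f. Poly_Mapping.keys f \<subseteq> monomials X}"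
  and mult_poly_ring: "mult (poly_ring X) = (*)"
  and add_poly_ring: "add (poly_ring X) = (+)"
  and one_poly_ring: "one (poly_ring X) = 1"
  and zero_poly_ring: "zero (poly_ring X) = 0"
  by (simp_all add: poly_ring_def)

lemmas poly_ring_sel =
  carrier_poly_ring mult_poly_ring add_poly_ring one_poly_ring zero_poly_ring

lemma keys_add_nat:
  fixes \<mu> \<nu> :: "'v \<Rightarrow>\<^sub>0 nat"
  shows "Poly_Mapping.keys (\<mu> + \<nu>) = Poly_Mapping.keys \<mu> \<union> Poly_Mapping.keys \<nu>"
  by (auto simp: in_keys_iff lookup_add)

lemma monomials_add_iff: "\<mu> + \<nu> \<in> monomials X \<longleftrightarrow> \<mu> \<in> monomials X \<and> \<nu> \<in> monomials X"
  by (simp add: monomials_def keys_add_nat)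

lemma zero_in_monomials: "0 \<in> monomials X"
  by (simp add: monomials_def)

lemma keys_var [simp]: "Poly_Mapping.keys (var x) = {x}"
  by (simp add: var_def)

lemma lookup_var: "Poly_Mapping.lookup (var x) v = of_bool (v = x)"
  by (auto simp: var_def lookup_single)

lemma var_in_monomials: "var x \<in> monomials X \<longleftrightarrow> x \<in> X"
  by (simp add: monomials_def)

lemma mdvd_iff_lookup_le:
  "\<mu> mdvd \<nu> \<longleftrightarrow> (\<forall>v. Poly_Mapping.lookup \<mu> v \<le> Poly_Mapping.lookup \<nu> v)"
proof
  assume "\<forall>v. Poly_Mapping.lookup \<mu> v \<le> Poly_Mapping.lookup \<nu> v"
  then have "\<nu> = \<mu> + (\<nu> - \<mu>)"
    by (intro poly_mapping_eqI) (simp add: lookup_add lookup_minus)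
  then show "\<mu> mdvd \<nu>"
    unfolding mdvd_def by blast
qed (auto simp: mdvd_def lookup_add)

lemma mdvd_refl: "\<mu> mdvd \<mu>"
  by (simp add: mdvd_iff_lookup_le)

lemma mdvd_trans: "\<mu> mdvd \<nu> \<Longrightarrow> \<nu> mdvd \<kappa> \<Longrightarrow> \<mu> mdvd \<kappa>"
  using le_trans unfolding mdvd_iff_lookup_le by blast

lemma var_mdvd_iff: "var x mdvd \<mu> \<longleftrightarrow> x \<in> Poly_Mapping.keys \<mu>"
  by (auto simp: mdvd_iff_lookup_le lookup_var in_keys_iff Suc_le_eq)

lemma var_add_var_mdvd:
  assumes "x \<in> Poly_Mapping.keys \<mu>" and "y \<in> Poly_Mapping.keys \<mu>" and "x \<noteq> y"
  shows "var x + var y mdvd \<mu>"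
  using assms by (auto simp: mdvd_iff_lookup_le lookup_add lookup_var in_keys_iff Suc_le_eq)

lemma mon_mult: "mon \<mu> * mon \<nu> = mon (\<mu> + \<nu>)"
  by (simp add: mon_def mult_single)

lemma mon_in_carrier: "mon \<mu> \<in> carrier (poly_ring X) \<longleftrightarrow> \<mu> \<in> monomials X"
  by (simp add: mon_def carrier_poly_ring)

lemma cring_poly_ring: "cring (poly_ring X :: (('v \<Rightarrow>\<^sub>0 nat) \<Rightarrow>\<^sub>0 'k::field) ring)"
proof (rule cringI)
  show "abelian_group (poly_ring X :: (('v \<Rightarrow>\<^sub>0 nat) \<Rightarrow>\<^sub>0 'k) ring)"
  proof (rule abelian_groupI)
    fix f :: "('v \<Rightarrow>\<^sub>0 nat) \<Rightarrow>\<^sub>0 'k"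
    assume "f \<in> carrier (poly_ring X)"
    then show "\<exists>g\<in>carrier (poly_ring X). g \<oplus>\<^bsub>poly_ring X\<^esub> f = \<zero>\<^bsub>poly_ring X\<^esub>"
      by (intro bexI[of _ "- f"]) (auto simp: poly_ring_sel)
  qed (use keys_add in \<open>fastforce simp: poly_ring_sel algebra_simps\<close>)+
  show "comm_monoid (poly_ring X :: (('v \<Rightarrow>\<^sub>0 nat) \<Rightarrow>\<^sub>0 'k) ring)"
  proof (rule comm_monoidI)
    fix f g :: "('v \<Rightarrow>\<^sub>0 nat) \<Rightarrow>\<^sub>0 'k"
    assume "f \<in> carrier (poly_ring X)" "g \<in> carrier (poly_ring X)"
    then show "f \<otimes>\<^bsub>poly_ring X\<^esub> g \<in> carrier (poly_ring X)"
      using keys_mult[of f g] monomials_add_iff by (fastforce simp: poly_ring_sel)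
  qed (auto simp: poly_ring_sel algebra_simps zero_in_monomials)
qed (simp add: poly_ring_sel algebra_simps)

lemma uminus_poly_ring:
  assumes "f \<in> carrier (poly_ring X)"
  shows "\<ominus>\<^bsub>poly_ring X\<^esub> f = - f"
proof -
  interpret cring "poly_ring X :: (('a \<Rightarrow>\<^sub>0 nat) \<Rightarrow>\<^sub>0 'b) ring"
    by (rule cring_poly_ring)
  show ?thesis
    by (rule minus_equality) (use assms in \<open>auto simp: poly_ring_sel\<close>)
qed

text \<open>
  The set on the right is an ideal because a term of a product is a multiple of a term of each
  factor; it is the smallest one containing \<open>mon ` M\<close> because an ideal is closed under sums of
  multiples of monomials.
\<close>

lemma Idl_mon_eq:
  fixes M :: "('v \<Rightarrow>\<^sub>0 nat) set"
  assumes M: "M \<subseteq> monomials X"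
  shows "Idl\<^bsub>poly_ring X\<^esub> (mon ` M) =
    {f :: ('v \<Rightarrow>\<^sub>0 nat) \<Rightarrow>\<^sub>0 'k::field.
       Poly_Mapping.keys f \<subseteq> {\<mu> \<in> monomials X. \<exists>\<nu>\<in>M. \<nu> mdvd \<mu>}}" (is "_ = ?I")
proof -
  let ?R = "poly_ring X :: (('v \<Rightarrow>\<^sub>0 nat) \<Rightarrow>\<^sub>0 'k) ring"
  interpret R: cring ?R
    by (rule cring_poly_ring)
  have mult_I: "f * g \<in> ?I" if f: "f \<in> ?I" and g: "g \<in> carrier ?R" for f g
  proof -
    have "\<mu> + \<kappa> \<in> monomials X \<and> (\<exists>\<nu>\<in>M. \<nu> mdvd \<mu> + \<kappa>)"
      if "\<mu> \<in> Poly_Mapping.keys f" "\<kappa> \<in> Poly_Mapping.keys g" for \<mu> \<kappa>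
    proof -
      have "\<mu> mdvd \<mu> + \<kappa>" by (auto simp: mdvd_def)
      then show ?thesis
        using that f g mdvd_trans by (fastforce simp: monomials_add_iff carrier_poly_ring)
    qed
    then show ?thesis
      using keys_mult[of f g] by fastforce
  qed
  have "ideal ?I ?R"
  proof (rule idealI)
    show "ring ?R" by (rule R.ring_axioms)
    show "subgroup ?I (add_monoid ?R)"
    proof (rule R.add.subgroupI)
      show "?I \<noteq> {}" by (rule ccontr) (auto dest: spec[of _ 0])
      show "?I \<subseteq> carrier ?R" by (auto simp: carrier_poly_ring)
      show "\<ominus>\<^bsub>?R\<^esub> f \<in> ?I" if "f \<in> ?I" for f
      proof -
        have "f \<in> carrier ?R"
          using that by (auto simp: carrier_poly_ring)
        then show ?thesis
          using that by (simp add: uminus_poly_ring)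
      qed
      show "f \<oplus>\<^bsub>?R\<^esub> g \<in> ?I" if "f \<in> ?I" "g \<in> ?I" for f g
        using that keys_add[of f g] by (auto simp: add_poly_ring)
    qed
    show "g \<otimes>\<^bsub>?R\<^esub> f \<in> ?I" "f \<otimes>\<^bsub>?R\<^esub> g \<in> ?I" if "f \<in> ?I" "g \<in> carrier ?R" for f g
      using mult_I[OF that] by (simp_all add: mult_poly_ring mult.commute)
  qed
  moreover have "mon ` M \<subseteq> ?I"
    using M by (fastforce simp: mon_def intro: mdvd_refl)
  ultimately have "Idl\<^bsub>?R\<^esub> (mon ` M) \<subseteq> ?I"
    by (rule R.genideal_minimal)
  moreover have "?I \<subseteq> Idl\<^bsub>?R\<^esub> (mon ` M)" (is "_ \<subseteq> ?J")
  proof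
    fix f assume f: "f \<in> ?I"
    have M_carrier: "mon ` M \<subseteq> carrier ?R"
      using M mon_in_carrier by fastforce
    interpret J: ideal ?J ?R
      by (rule R.genideal_ideal[OF M_carrier])
    have single_in_J: "Poly_Mapping.single \<mu> c \<in> ?J" if "\<mu> \<in> monomials X" "\<nu> \<in> M" "\<nu> mdvd \<mu>"
      for \<mu> \<nu> and c :: 'k
    proof -
      obtain \<kappa> where \<kappa>: "\<mu> = \<nu> + \<kappa>"
        using \<open>\<nu> mdvd \<mu>\<close> by (auto simp: mdvd_def)
      have "mon \<nu> \<in> ?J"
        using R.genideal_self[OF M_carrier] \<open>\<nu> \<in> M\<close> by auto
      moreover have "Poly_Mapping.single \<kappa> c \<in> carrier ?R"
        using that \<kappa> by (auto simp: carrier_poly_ring monomials_add_iff)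
      ultimately have "mon \<nu> * Poly_Mapping.single \<kappa> c \<in> ?J"
        using J.I_r_closed by (simp add: mult_poly_ring)
      then show ?thesis
        by (simp add: \<kappa> mon_def mult_single)
    qed
    have "(\<Sum>\<mu>\<in>A. Poly_Mapping.single \<mu> (Poly_Mapping.lookup f \<mu>)) \<in> ?J"
      if "finite A" "A \<subseteq> Poly_Mapping.keys f" for A
      using that
    proof (induction A rule: finite_induct)
      case empty
      then show ?case using J.zero_closed by (simp add: zero_poly_ring)
    next
      case (insert \<mu> A)
      then have "Poly_Mapping.single \<mu> (Poly_Mapping.lookup f \<mu>) \<in> ?J"
        using f single_in_J by auto
      then show ?case
        using insert J.a_closed by (simp add: add_poly_ring)
    qed
    then have "(\<Sum>\<mu>\<in>Poly_Mapping.keys f. Poly_Mapping.single \<mu> (Poly_Mapping.lookup f \<mu>)) \<in> ?J"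
      by simp
    also have "(\<Sum>\<mu>\<in>Poly_Mapping.keys f. Poly_Mapping.single \<mu> (Poly_Mapping.lookup f \<mu>)) = f"
      by (rule poly_mapping_eqI) (simp add: lookup_sum lookup_single when_def in_keys_iff)
    finally show "f \<in> ?J" .
  qed
  ultimately show ?thesis by blast
qed

lemma Idl_mon_subset_iff:
  fixes M N :: "('v \<Rightarrow>\<^sub>0 nat) set"
  assumes "M \<subseteq> monomials X" and "N \<subseteq> monomials X"
  shows "(Idl\<^bsub>poly_ring X\<^esub> (mon ` M) :: (('v \<Rightarrow>\<^sub>0 nat) \<Rightarrow>\<^sub>0 'k::field) set)
           \<subseteq> Idl\<^bsub>poly_ring X\<^esub> (mon ` N) \<longleftrightarrow> (\<forall>\<mu>\<in>M. \<exists>\<nu>\<in>N. \<nu> mdvd \<mu>)" (is "?L \<longleftrightarrow> ?R")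
proof
  assume L: ?L
  show ?R
  proof
    fix \<mu> assume "\<mu> \<in> M"
    then have "(mon \<mu> :: ('v \<Rightarrow>\<^sub>0 nat) \<Rightarrow>\<^sub>0 'k) \<in> Idl\<^bsub>poly_ring X\<^esub> (mon ` M)"
      unfolding Idl_mon_eq[OF assms(1)] using assms(1) by (fastforce simp: mon_def intro: mdvd_refl)
    with L have "(mon \<mu> :: ('v \<Rightarrow>\<^sub>0 nat) \<Rightarrow>\<^sub>0 'k) \<in> Idl\<^bsub>poly_ring X\<^esub> (mon ` N)"
      by blast
    then show "\<exists>\<nu>\<in>N. \<nu> mdvd \<mu>"
      unfolding Idl_mon_eq[OF assms(2)] by (simp add: mon_def)
  qed
next
  assume ?R
  then have "{\<mu> \<in> monomials X. \<exists>\<nu>\<in>M. \<nu> mdvd \<mu>} \<subseteq> {\<mu> \<in> monomials X. \<exists>\<nu>\<in>N. \<nu> mdvd \<mu>}"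
    using mdvd_trans by blast
  then show ?L
    unfolding Idl_mon_eq[OF assms(1)] Idl_mon_eq[OF assms(2)] by blast
qed

text \<open>
  A member of the antichain \<open>A\<close> is divisible by a member of any other generating set \<open>M\<close>, which
  in turn is divisible by a member of \<open>A\<close>; so all three agree, and \<open>A \<subseteq> M\<close>.
\<close>

lemma is_min_mon_gens_antichain_iff:
  fixes A M :: "('v \<Rightarrow>\<^sub>0 nat) set"
  assumes A: "A \<subseteq> monomials X"
    and antichain: "\<And>\<mu> \<nu>. \<mu> \<in> A \<Longrightarrow> \<nu> \<in> A \<Longrightarrow> \<mu> mdvd \<nu> \<Longrightarrow> \<mu> = \<nu>"
  shows "is_min_mon_gens X
           (Idl\<^bsub>poly_ring X\<^esub> (mon ` A) :: (('v \<Rightarrow>\<^sub>0 nat) \<Rightarrow>\<^sub>0 'k::field) set) M \<longleftrightarrow> M = A"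
proof -
  have sub: "A \<subseteq> N" if N: "N \<subseteq> monomials X"
    and eq: "Idl\<^bsub>poly_ring X\<^esub> (mon ` N) =
      (Idl\<^bsub>poly_ring X\<^esub> (mon ` A) :: (('v \<Rightarrow>\<^sub>0 nat) \<Rightarrow>\<^sub>0 'k) set)" for N
  proof
    fix \<mu> assume "\<mu> \<in> A"
    then obtain \<nu> where \<nu>: "\<nu> \<in> N" "\<nu> mdvd \<mu>"
      using Idl_mon_subset_iff[OF A N, where 'k='k] eq by blast
    then obtain \<kappa> where \<kappa>: "\<kappa> \<in> A" "\<kappa> mdvd \<nu>"
      using Idl_mon_subset_iff[OF N A, where 'k='k] eq by blast
    have "\<kappa> = \<mu>"
      using antichain \<kappa> \<nu> \<open>\<mu> \<in> A\<close> mdvd_trans by blast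
    with \<kappa> \<nu> have "\<forall>v. Poly_Mapping.lookup \<mu> v = Poly_Mapping.lookup \<nu> v"
      by (auto simp: mdvd_iff_lookup_le intro: antisym)
    then show "\<mu> \<in> N"
      using \<nu> poly_mapping_eqI by metis
  qed
  show ?thesis
  proof
    assume M: "is_min_mon_gens X
      (Idl\<^bsub>poly_ring X\<^esub> (mon ` A) :: (('v \<Rightarrow>\<^sub>0 nat) \<Rightarrow>\<^sub>0 'k) set) M"
    then have "A \<subseteq> M"
      using sub by (simp add: is_min_mon_gens_def)
    then show "M = A"
      using M unfolding is_min_mon_gens_def by blast
  next
    assume "M = A"
    then show "is_min_mon_gens X
      (Idl\<^bsub>poly_ring X\<^esub> (mon ` A) :: (('v \<Rightarrow>\<^sub>0 nat) \<Rightarrow>\<^sub>0 'k) set) M"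
      using A sub unfolding is_min_mon_gens_def by blast
  qed
qed

section \<open>Initial monomials of the defining ideal of a Rees algebra\<close>

definition rees_var :: "(nat \<Rightarrow> (indet \<Rightarrow>\<^sub>0 nat)) \<Rightarrow> indet \<Rightarrow> (indet \<Rightarrow>\<^sub>0 nat)"
  where "rees_var u x = (case x of Yv r \<Rightarrow> u r + var Tv | _ \<Rightarrow> var x)"

text \<open>
  The exponent of the monomial \<open>\<pi>(\<mu>)\<close>.  The inner sum is the multiple of \<open>rees_var u x\<close> by the
  exponent of \<open>x\<close>.
\<close>

definition rees_exp :: "(nat \<Rightarrow> (indet \<Rightarrow>\<^sub>0 nat)) \<Rightarrow> (indet \<Rightarrow>\<^sub>0 nat) \<Rightarrow> (indet \<Rightarrow>\<^sub>0 nat)"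
  where "rees_exp u \<mu> =
    (\<Sum>x\<in>Poly_Mapping.keys \<mu>. \<Sum>_<Poly_Mapping.lookup \<mu> x. rees_var u x)"

lemma lookup_rees_exp:
  assumes "finite F" and "Poly_Mapping.keys \<mu> \<subseteq> F"
  shows "Poly_Mapping.lookup (rees_exp u \<mu>) v =
    (\<Sum>x\<in>F. Poly_Mapping.lookup \<mu> x * Poly_Mapping.lookup (rees_var u x) v)"
proof -
  have "Poly_Mapping.lookup (rees_exp u \<mu>) v =
      (\<Sum>x\<in>Poly_Mapping.keys \<mu>. Poly_Mapping.lookup \<mu> x * Poly_Mapping.lookup (rees_var u x) v)"
    by (simp add: rees_exp_def lookup_sum)
  also have "\<dots> = (\<Sum>x\<in>F. Poly_Mapping.lookup \<mu> x * Poly_Mapping.lookup (rees_var u x) v)"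
    by (rule sum.mono_neutral_left) (use assms in \<open>auto simp: in_keys_iff\<close>)
  finally show ?thesis .
qed

lemma rees_exp_add: "rees_exp u (\<mu> + \<nu>) = rees_exp u \<mu> + rees_exp u \<nu>"
proof (rule poly_mapping_eqI)
  fix v
  let ?F = "Poly_Mapping.keys \<mu> \<union> Poly_Mapping.keys \<nu>"
  show "Poly_Mapping.lookup (rees_exp u (\<mu> + \<nu>)) v =
    Poly_Mapping.lookup (rees_exp u \<mu> + rees_exp u \<nu>) v"
    using lookup_rees_exp[of ?F "\<mu> + \<nu>" u v] lookup_rees_exp[of ?F \<mu> u v]
      lookup_rees_exp[of ?F \<nu> u v]
    by (simp add: keys_add_nat lookup_add sum.distrib algebra_simps)
qed

lemma rees_exp_var: "rees_exp u (var x) = rees_var u x"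
  by (simp add: rees_exp_def lookup_var)

lemma mon_zero: "mon 0 = 1"
  by (simp add: mon_def)

lemma mon_power: "mon \<mu> ^ k = mon (\<Sum>_<k. \<mu>)"
  by (induction k) (simp_all add: mon_mult mon_zero add.commute)

lemma mon_sum: "(\<Prod>x\<in>A. mon (g x)) = mon (\<Sum>x\<in>A. g x)"
  by (induction A rule: infinite_finite_induct) (simp_all add: mon_mult mon_zero)

lemma rees_map_eq:
  "rees_map u f = (\<Sum>\<mu>\<in>Poly_Mapping.keys f.
     Poly_Mapping.single (rees_exp u \<mu>) (Poly_Mapping.lookup f \<mu>))"
proof -
  have var: "(case x of Yv r \<Rightarrow> mon (u r) * mon (var Tv) | _ \<Rightarrow> mon (var x)) =
      (mon (rees_var u x) :: (indet \<Rightarrow>\<^sub>0 nat) \<Rightarrow>\<^sub>0 'a)" for x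
    by (cases x) (simp_all add: rees_var_def mon_mult)
  have single: "const c * mon \<tau> = Poly_Mapping.single \<tau> c"
    for c :: 'a and \<tau> :: "indet \<Rightarrow>\<^sub>0 nat"
    by (simp add: const_def mon_def mult_single)
  show ?thesis
    unfolding rees_map_def eval_hom_def var mon_power mon_sum single rees_exp_def ..
qed

lemma lookup_rees_map:
  "Poly_Mapping.lookup (rees_map u f) \<tau> =
     (\<Sum>\<mu> | \<mu> \<in> Poly_Mapping.keys f \<and> rees_exp u \<mu> = \<tau>. Poly_Mapping.lookup f \<mu>)"
  unfolding rees_map_eq lookup_sum lookup_single
  by (rule sum.mono_neutral_cong_right) auto

lemma rees_ideal_eq:
  "rees_ideal V s u = {f \<in> carrier (poly_ring (T_indets V s)). rees_map u f = 0}"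
  unfolding rees_ideal_def a_kernel_def kernel_def rees_algebra_def
  by (simp add: poly_ring_def)

text \<open>
  The coefficients of \<open>f\<close> in the kernel sum to zero over each fibre of \<open>\<pi>\<close> on monomials, so no
  term of \<open>f\<close> is alone in its fibre; conversely two monomials of one fibre give a binomial in the
  kernel.
\<close>

lemma initial_mons_rees_ideal:
  "{\<mu>. \<exists>f \<in> (rees_ideal V s u :: ((indet \<Rightarrow>\<^sub>0 nat) \<Rightarrow>\<^sub>0 'k::field) set). is_initial_mon lt f \<mu>} =
   {\<mu> \<in> monomials (T_indets V s).
      \<exists>\<nu> \<in> monomials (T_indets V s). \<nu> \<noteq> \<mu> \<and> rees_exp u \<nu> = rees_exp u \<mu> \<and> lt \<nu> \<mu>}"
  (is "?L = ?R")
proof (intro Set.set_eqI iffI)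
  fix \<mu> assume "\<mu> \<in> ?L"
  then obtain f :: "(indet \<Rightarrow>\<^sub>0 nat) \<Rightarrow>\<^sub>0 'k" where f: "f \<in> rees_ideal V s u"
    and initial: "is_initial_mon lt f \<mu>"
    by blast
  let ?F = "{\<nu> \<in> Poly_Mapping.keys f. rees_exp u \<nu> = rees_exp u \<mu>}"
  have \<mu>: "\<mu> \<in> ?F" "Poly_Mapping.lookup f \<mu> \<noteq> 0"
    using initial by (auto simp: is_initial_mon_def in_keys_iff)
  have "(\<Sum>\<nu>\<in>?F. Poly_Mapping.lookup f \<nu>) = 0"
    using f lookup_rees_map[of u f "rees_exp u \<mu>"] by (simp add: rees_ideal_eq)
  with \<mu> have "?F \<noteq> {\<mu>}"
    by (metis (no_types, lifting) finite.emptyI sum.insert sum.empty add.right_neutral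
        empty_iff)
  with \<mu> obtain \<nu> where "\<nu> \<in> ?F" "\<nu> \<noteq> \<mu>"
    by blast
  then show "\<mu> \<in> ?R"
    using f initial by (auto simp: rees_ideal_eq carrier_poly_ring is_initial_mon_def)
next
  fix \<mu> assume "\<mu> \<in> ?R"
  then obtain \<nu> where \<mu>: "\<mu> \<in> monomials (T_indets V s)" and \<nu>: "\<nu> \<in> monomials (T_indets V s)"
    "\<nu> \<noteq> \<mu>" "rees_exp u \<nu> = rees_exp u \<mu>" "lt \<nu> \<mu>"
    by blast
  define f :: "(indet \<Rightarrow>\<^sub>0 nat) \<Rightarrow>\<^sub>0 'k" where "f = mon \<mu> - mon \<nu>"
  have lookup_f: "Poly_Mapping.lookup f \<kappa> = of_bool (\<kappa> = \<mu>) - of_bool (\<kappa> = \<nu>)" for \<kappa>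
    by (auto simp: f_def mon_def lookup_minus lookup_single)
  have keys_f: "Poly_Mapping.keys f = {\<mu>, \<nu>}"
    using \<nu> by (auto simp: in_keys_iff lookup_f)
  have "Poly_Mapping.lookup (rees_map u f) \<tau> = 0" for \<tau>
  proof -
    have "{\<kappa> \<in> {\<mu>, \<nu>}. rees_exp u \<kappa> = \<tau>} = (if rees_exp u \<mu> = \<tau> then {\<mu>, \<nu>} else {})"
      using \<nu> by auto
    then show ?thesis
      using \<nu> by (simp add: lookup_rees_map keys_f lookup_f)
  qed
  then have "f \<in> rees_ideal V s u"
    using \<mu> \<nu> by (auto simp: rees_ideal_eq carrier_poly_ring keys_f intro: poly_mapping_eqI)
  moreover have "is_initial_mon lt f \<mu>"
    using \<nu> by (simp add: is_initial_mon_def keys_f)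
  ultimately show "\<mu> \<in> ?L"
    by blast
qed

section \<open>The lexicographic order\<close>

lemma lex_less_asym:
  assumes "lex_less xs \<mu> \<nu>"
  shows "\<not> lex_less xs \<nu> \<mu>"
proof
  assume "lex_less xs \<nu> \<mu>"
  then obtain i where i: "Poly_Mapping.lookup \<nu> (xs ! i) < Poly_Mapping.lookup \<mu> (xs ! i)"
    "\<And>j. j < i \<Longrightarrow> Poly_Mapping.lookup \<nu> (xs ! j) = Poly_Mapping.lookup \<mu> (xs ! j)"
    unfolding lex_less_def by blast
  obtain k where k: "Poly_Mapping.lookup \<mu> (xs ! k) < Poly_Mapping.lookup \<nu> (xs ! k)"
    "\<And>j. j < k \<Longrightarrow> Poly_Mapping.lookup \<mu> (xs ! j) = Poly_Mapping.lookup \<nu> (xs ! j)"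
    using assms unfolding lex_less_def by blast
  show False
    using i(1) i(2)[of k] k(1) k(2)[of i] by (cases i k rule: linorder_cases) auto
qed

text \<open>
  Positions in the list enter only through its prefixes: a variable outside a prefix that is the
  first to differ certifies agreement on the whole prefix.
\<close>

lemma lex_less_first_difference:
  assumes "lex_less xs \<mu> \<nu>"
  obtains v where "v \<in> set xs" "Poly_Mapping.lookup \<mu> v < Poly_Mapping.lookup \<nu> v"
    and "\<And>ys zs w. xs = ys @ zs \<Longrightarrow> v \<notin> set ys \<Longrightarrow> w \<in> set ys \<Longrightarrow>
      Poly_Mapping.lookup \<mu> w = Poly_Mapping.lookup \<nu> w"
proof -
  obtain i where i: "i < length xs" "Poly_Mapping.lookup \<mu> (xs ! i) < Poly_Mapping.lookup \<nu> (xs ! i)"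
    "\<And>j. j < i \<Longrightarrow> Poly_Mapping.lookup \<mu> (xs ! j) = Poly_Mapping.lookup \<nu> (xs ! j)"
    using assms unfolding lex_less_def by blast
  have "Poly_Mapping.lookup \<mu> w = Poly_Mapping.lookup \<nu> w"
    if "xs = ys @ zs" "xs ! i \<notin> set ys" "w \<in> set ys" for ys zs w
  proof -
    have "length ys \<le> i"
    proof (rule ccontr)
      assume "\<not> length ys \<le> i"
      then show False
        using that nth_mem[of i ys] by (simp add: nth_append)
    qed
    moreover obtain j where "j < length ys" "w = ys ! j"
      using \<open>w \<in> set ys\<close> by (auto simp: in_set_conv_nth)
    ultimately show ?thesis
      using i(3)[of j] that(1) by (simp add: nth_append)
  qed
  with that[of "xs ! i"] i(1,2) show thesis
    by simp
qed

text \<open>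
  The variable \<open>w\<close> need not be the first one to differ: on the prefix \<open>ys\<close> every difference is in
  favour of \<open>\<nu>\<close>.
\<close>

lemma lex_lessI:
  assumes xs: "xs = ys @ zs" and w: "w \<in> set ys"
    and less: "Poly_Mapping.lookup \<mu> w < Poly_Mapping.lookup \<nu> w"
    and le: "\<And>v. v \<in> set ys \<Longrightarrow> Poly_Mapping.lookup \<mu> v \<le> Poly_Mapping.lookup \<nu> v"
  shows "lex_less xs \<mu> \<nu>"
proof -
  let ?P = "\<lambda>i. i < length ys \<and> Poly_Mapping.lookup \<mu> (ys ! i) < Poly_Mapping.lookup \<nu> (ys ! i)"
  define i where "i = (LEAST i. ?P i)"
  have "\<exists>i. ?P i"
    using w less by (auto simp: in_set_conv_nth)
  then have i: "?P i"
    unfolding i_def by (rule LeastI_ex)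
  have "Poly_Mapping.lookup \<mu> (ys ! j) = Poly_Mapping.lookup \<nu> (ys ! j)" if "j < i" for j
  proof -
    have "\<not> ?P j"
      using that not_less_Least unfolding i_def by blast
    then show ?thesis
      using le[of "ys ! j"] that i by (auto simp: le_less)
  qed
  with i show ?thesis
    unfolding lex_less_def xs by (intro exI[of _ i]) (auto simp: nth_append)
qed

lemma cw_vertex_list_prefixes:
  obtains as bcs rest where "cw_vertex_list n m p q = as @ bcs @ rest"
    "set as = {Av i k | i k. i \<in> {1..n} \<and> k \<in> {1..p i}}"
    "set bcs = {Bv j k | j k. j \<in> {1..m} \<and> k \<in> {1..q j}} \<union>
       {Cv j k | j k. j \<in> {1..m} \<and> k \<in> {1..q j}}"
proof
  show "cw_vertex_list n m p q =
    concat (map (\<lambda>i. map (\<lambda>k. Av i k) [1..<Suc (p i)]) [1..<Suc n]) @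
    concat (map (\<lambda>j. concat (map (\<lambda>k. [Bv j k, Cv j k]) [1..<Suc (q j)])) [1..<Suc m]) @
    (map Zeta [1..<Suc m] @ map Xi [1..<Suc n])"
    by (simp add: cw_vertex_list_def)
qed (auto simp del: upt_Suc simp: atLeastLessThanSuc_atLeastAtMost)

lemma upt_split_at:
  assumes "j \<in> {1..n}"
  shows "[1..<Suc n] = [1..<j] @ j # [Suc j..<Suc n]"
proof -
  have "[1..<j + (Suc n - j)] = [1..<j] @ [j..<j + (Suc n - j)]"
    using assms by (intro upt_add_eq_append) simp
  moreover have "j + (Suc n - j) = Suc n" "[j..<Suc n] = j # [Suc j..<Suc n]"
    using assms by (auto intro: upt_conv_Cons simp del: upt_Suc)
  ultimately show ?thesis
    by (simp only:)
qed

lemma cw_vertex_list_split_triangle: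
  assumes j: "j \<in> {1..m}" and k: "k \<in> {1..q j}"
  obtains ys zs where "cw_vertex_list n m p q = ys @ zs" "Bv j k \<in> set ys" "Cv j k \<notin> set ys"
proof -
  define bc where "bc j' ks = concat (map (\<lambda>k. [Bv j' k, Cv j' k]) ks)" for j' ks
  define bcs where "bcs js = concat (map (\<lambda>j'. bc j' [1..<Suc (q j')]) js)" for js
  define as where "as = concat (map (\<lambda>i. map (\<lambda>k. Av i k) [1..<Suc (p i)]) [1..<Suc n])"
  define rest where "rest = map Zeta [1..<Suc m] @ map Xi [1..<Suc n]"
  have "cw_vertex_list n m p q = as @ bcs [1..<Suc m] @ rest"
    by (simp add: cw_vertex_list_def as_def bcs_def bc_def rest_def)
  also have "bcs [1..<Suc m] = bcs [1..<j] @ bc j [1..<Suc (q j)] @ bcs [Suc j..<Suc m]"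
    unfolding upt_split_at[OF j] by (simp add: bcs_def)
  also have "bc j [1..<Suc (q j)] = bc j [1..<k] @ [Bv j k] @ [Cv j k] @ bc j [Suc k..<Suc (q j)]"
    unfolding upt_split_at[OF k] by (simp add: bc_def)
  finally have "cw_vertex_list n m p q =
      (as @ bcs [1..<j] @ bc j [1..<k] @ [Bv j k]) @
      ([Cv j k] @ bc j [Suc k..<Suc (q j)] @ bcs [Suc j..<Suc m] @ rest)"
    by simp
  moreover have "Cv j k \<notin> set (as @ bcs [1..<j] @ bc j [1..<k] @ [Bv j k])"
    by (auto simp: as_def bcs_def bc_def)
  ultimately show thesis
    by (intro that) (assumption, simp_all)
qed

section \<open>Minimal vertex covers\<close>

text \<open>If no edge has \<open>v\<close> as its only vertex in the cover, then \<open>v\<close> can be dropped.\<close>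

lemma minimal_vertex_cover_iff_private_edge:
  "minimal_vertex_cover V E C \<longleftrightarrow> vertex_cover V E C \<and> (\<forall>v\<in>C. \<exists>e\<in>E. e \<inter> C = {v})"
proof
  assume C: "minimal_vertex_cover V E C"
  then have sub: "C \<subseteq> V" and cover: "\<And>e. e \<in> E \<Longrightarrow> e \<inter> C \<noteq> {}"
    by (simp_all add: minimal_vertex_cover_def vertex_cover_def)
  have "\<exists>e\<in>E. e \<inter> C = {v}" if "v \<in> C" for v
  proof -
    have "C - {v} \<subset> C"
      using that by blast
    then have "\<not> vertex_cover V E (C - {v})"
      using C unfolding minimal_vertex_cover_def by blast
    then obtain e where e: "e \<in> E" "e \<inter> (C - {v}) = {}"
      using sub unfolding vertex_cover_def by blast
    with cover[of e] have "e \<inter> C = {v}"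
      by blast
    with e show ?thesis
      by blast
  qed
  with C show "vertex_cover V E C \<and> (\<forall>v\<in>C. \<exists>e\<in>E. e \<inter> C = {v})"
    by (simp add: minimal_vertex_cover_def)
next
  assume C: "vertex_cover V E C \<and> (\<forall>v\<in>C. \<exists>e\<in>E. e \<inter> C = {v})"
  have "\<not> vertex_cover V E D" if "D \<subset> C" for D
  proof -
    obtain v where v: "v \<in> C" "v \<notin> D"
      using \<open>D \<subset> C\<close> by blast
    with C obtain e where "e \<in> E" "e \<inter> C = {v}"
      by blast
    moreover have "e \<inter> D \<subseteq> e \<inter> C - {v}"
      using v \<open>D \<subset> C\<close> by blast
    ultimately show ?thesis
      unfolding vertex_cover_def by auto
  qed
  with C show "minimal_vertex_cover V E C"
    by (simp add: minimal_vertex_cover_def)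
qed

definition cover_mon :: "'v set \<Rightarrow> ('v \<Rightarrow>\<^sub>0 nat)"
  where "cover_mon C = (\<Sum>v\<in>C. var v)"

lemma lookup_cover_mon: "finite C \<Longrightarrow> Poly_Mapping.lookup (cover_mon C) v = of_bool (v \<in> C)"
  by (simp add: cover_mon_def lookup_sum lookup_var of_bool_def)

lemma keys_cover_mon [simp]: "finite C \<Longrightarrow> Poly_Mapping.keys (cover_mon C) = C"
  by (auto simp: in_keys_iff lookup_cover_mon)

lemma minimal_vertex_cover_finite: "finite V \<Longrightarrow> minimal_vertex_cover V E C \<Longrightarrow> finite C"
  by (auto simp: minimal_vertex_cover_def vertex_cover_def intro: finite_subset)

text \<open>
  The monomials of the minimal vertex covers generate the ideal by definition, and minimality of
  the covers makes them an antichain.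
\<close>

lemma is_min_mon_gens_vertex_cover_ideal_iff:
  fixes V :: "'v set"
  assumes "finite V"
  shows "is_min_mon_gens V (vertex_cover_ideal V E :: (('v \<Rightarrow>\<^sub>0 nat) \<Rightarrow>\<^sub>0 'k::field) set) M \<longleftrightarrow>
    M = cover_mon ` {C. minimal_vertex_cover V E C}"
proof -
  let ?M = "cover_mon ` {C. minimal_vertex_cover V E C}"
  have "{\<Prod>v\<in>C. mon (var v) | C. minimal_vertex_cover V E C} =
      (mon ` ?M :: (('v \<Rightarrow>\<^sub>0 nat) \<Rightarrow>\<^sub>0 'k) set)"
    by (auto simp: mon_sum cover_mon_def)
  then have ideal: "vertex_cover_ideal V E =
      (Idl\<^bsub>poly_ring V\<^esub> (mon ` ?M) :: (('v \<Rightarrow>\<^sub>0 nat) \<Rightarrow>\<^sub>0 'k) set)"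
    by (simp add: vertex_cover_ideal_def)
  show ?thesis
    unfolding ideal
  proof (rule is_min_mon_gens_antichain_iff)
    show "?M \<subseteq> monomials V"
      using minimal_vertex_cover_finite[OF assms]
      by (auto simp: monomials_def minimal_vertex_cover_def vertex_cover_def)
    fix \<mu> \<nu> assume "\<mu> \<in> ?M" "\<nu> \<in> ?M" "\<mu> mdvd \<nu>"
    then obtain C D where CD: "minimal_vertex_cover V E C" "minimal_vertex_cover V E D"
      "\<mu> = cover_mon C" "\<nu> = cover_mon D"
      by blast
    then have "finite C" "finite D"
      using minimal_vertex_cover_finite[OF assms] by auto
    then have "C \<subseteq> D"
      using \<open>\<mu> mdvd \<nu>\<close> CD keys_add_nat keys_cover_mon
      by (metis mdvd_def sup_ge1)
    with CD show "\<mu> = \<nu>"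
      unfolding minimal_vertex_cover_def by blast
  qed
qed

locale cameron_walker =
  fixes n m :: nat and p q :: "nat \<Rightarrow> nat"
  assumes p_pos: "i \<in> {1..n} \<Longrightarrow> p i \<ge> 1"
begin

abbreviation "V \<equiv> cw_vertices n m p q"
abbreviation "E \<equiv> cw_edges n m p q"

lemma finite_V: "finite V"
  by (metis finite_set set_cw_vertex_list)

lemma in_V_iff [simp]:
  "Av i k \<in> V \<longleftrightarrow> i \<in> {1..n} \<and> k \<in> {1..p i}"
  "Bv j k \<in> V \<longleftrightarrow> j \<in> {1..m} \<and> k \<in> {1..q j}"
  "Cv j k \<in> V \<longleftrightarrow> j \<in> {1..m} \<and> k \<in> {1..q j}"
  "Zeta j \<in> V \<longleftrightarrow> j \<in> {1..m}"
  "Xi i \<in> V \<longleftrightarrow> i \<in> {1..n}"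
  "Yv r \<notin> V" "Tv \<notin> V"
  by (auto simp: cw_vertices_def)

lemma cw_edgesI:
  "i \<in> {1..n} \<Longrightarrow> j \<in> {1..m} \<Longrightarrow> {Xi i, Zeta j} \<in> E"
  "i \<in> {1..n} \<Longrightarrow> k \<in> {1..p i} \<Longrightarrow> {Xi i, Av i k} \<in> E"
  "j \<in> {1..m} \<Longrightarrow> k \<in> {1..q j} \<Longrightarrow> {Zeta j, Bv j k} \<in> E"
  "j \<in> {1..m} \<Longrightarrow> k \<in> {1..q j} \<Longrightarrow> {Zeta j, Cv j k} \<in> E"
  "j \<in> {1..m} \<Longrightarrow> k \<in> {1..q j} \<Longrightarrow> {Bv j k, Cv j k} \<in> E"
  unfolding cw_edges_def by blast+

lemma cw_edges_at_Av: "e \<in> E \<Longrightarrow> Av i k \<in> e \<Longrightarrow> e = {Xi i, Av i k}"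
  unfolding cw_edges_def by auto

lemma cw_edges_at_Bv:
  "e \<in> E \<Longrightarrow> Bv j k \<in> e \<Longrightarrow> e = {Zeta j, Bv j k} \<or> e = {Bv j k, Cv j k}"
  unfolding cw_edges_def by auto

lemma cw_edges_at_Zeta:
  "e \<in> E \<Longrightarrow> Zeta j \<in> e \<Longrightarrow> q j = 0 \<Longrightarrow> \<exists>i\<in>{1..n}. e = {Xi i, Zeta j}"
  unfolding cw_edges_def by auto

text \<open>
  Minimality enters through private edges: that of a leaf leads to \<open>\<xi>\<^sub>i\<close>, that of \<open>b\<^sub>j\<^sup>k\<close> beside a
  present \<open>\<zeta>\<^sub>j\<close> leads to \<open>c\<^sub>j\<^sup>k\<close> and vice versa, and that of a \<open>\<zeta>\<^sub>j\<close> without triangles leads to an absent \<open>\<xi>\<^sub>i\<close>.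
  All other presences in a minimal cover have a private edge automatically.
\<close>

lemma minimal_vertex_cover_cw_iff:
  "minimal_vertex_cover V E C \<longleftrightarrow>
     C \<subseteq> V \<and>
     (\<forall>i\<in>{1..n}. \<forall>k\<in>{1..p i}. Av i k \<in> C \<longleftrightarrow> Xi i \<notin> C) \<and>
     (\<forall>i\<in>{1..n}. \<forall>j\<in>{1..m}. Xi i \<in> C \<or> Zeta j \<in> C) \<and>
     (\<forall>j\<in>{1..m}. \<forall>k\<in>{1..q j}.
        (Zeta j \<in> C \<longrightarrow> (Bv j k \<in> C \<longleftrightarrow> Cv j k \<notin> C)) \<and>
        (Zeta j \<notin> C \<longrightarrow> Bv j k \<in> C \<and> Cv j k \<in> C)) \<and>
     ((\<forall>i\<in>{1..n}. Xi i \<in> C) \<longrightarrow> (\<forall>j\<in>{1..m}. q j = 0 \<longrightarrow> Zeta j \<notin> C))"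
  (is "_ \<longleftrightarrow> ?sub \<and> ?leaf \<and> ?bip \<and> ?tri \<and> ?zeta")
proof
  assume "minimal_vertex_cover V E C"
  then have sub: "C \<subseteq> V" and cover: "e \<in> E \<Longrightarrow> e \<inter> C \<noteq> {}"
    and private_edge: "v \<in> C \<Longrightarrow> \<exists>e\<in>E. e \<inter> C = {v}" for e v
    by (auto simp: minimal_vertex_cover_iff_private_edge vertex_cover_def)
  have ?leaf
  proof (intro ballI)
    fix i k assume ik: "i \<in> {1..n}" "k \<in> {1..p i}"
    have "Xi i \<in> C \<or> Av i k \<in> C"
      using cover[OF cw_edgesI(2)[OF ik]] by auto
    moreover have "Xi i \<notin> C" if a: "Av i k \<in> C"
    proof
      assume "Xi i \<in> C"
      moreover obtain e where "e \<in> E" "e \<inter> C = {Av i k}"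
        using private_edge[OF a] by blast
      ultimately show False
        using cw_edges_at_Av[of e i k] by blast
    qed
    ultimately show "Av i k \<in> C \<longleftrightarrow> Xi i \<notin> C" by blast
  qed
  moreover have ?bip
  proof (intro ballI)
    fix i j assume ij: "i \<in> {1..n}" "j \<in> {1..m}"
    show "Xi i \<in> C \<or> Zeta j \<in> C"
      using cover[OF cw_edgesI(1)[OF ij]] by auto
  qed
  moreover have ?tri
  proof (intro ballI)
    fix j k assume jk: "j \<in> {1..m}" "k \<in> {1..q j}"
    have "Zeta j \<in> C \<or> Bv j k \<in> C" "Zeta j \<in> C \<or> Cv j k \<in> C" "Bv j k \<in> C \<or> Cv j k \<in> C"
      using cover[OF cw_edgesI(3)[OF jk]] cover[OF cw_edgesI(4)[OF jk]]
        cover[OF cw_edgesI(5)[OF jk]] by auto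
    moreover have False if b: "Bv j k \<in> C" and "Cv j k \<in> C" "Zeta j \<in> C"
    proof -
      obtain e where "e \<in> E" "e \<inter> C = {Bv j k}"
        using private_edge[OF b] by blast
      then show False
        using that cw_edges_at_Bv[of e j k] by blast
    qed
    ultimately show "(Zeta j \<in> C \<longrightarrow> (Bv j k \<in> C \<longleftrightarrow> Cv j k \<notin> C)) \<and>
        (Zeta j \<notin> C \<longrightarrow> Bv j k \<in> C \<and> Cv j k \<in> C)" by blast
  qed
  moreover have ?zeta
  proof (intro impI ballI notI)
    fix j assume xi: "\<forall>i\<in>{1..n}. Xi i \<in> C" and "j \<in> {1..m}" "q j = 0" and z: "Zeta j \<in> C"
    from private_edge[OF z] obtain e where "e \<in> E" "e \<inter> C = {Zeta j}" by blast
    with xi \<open>q j = 0\<close> show False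
      using cw_edges_at_Zeta[of e j] by blast
  qed
  ultimately show "?sub \<and> ?leaf \<and> ?bip \<and> ?tri \<and> ?zeta" using sub by blast
next
  assume C: "?sub \<and> ?leaf \<and> ?bip \<and> ?tri \<and> ?zeta"
  then have sub: ?sub and leaf: ?leaf and bip: ?bip and tri: ?tri and zeta: ?zeta by blast+
  have "vertex_cover V E C"
    unfolding vertex_cover_def
  proof (intro conjI ballI)
    fix e assume "e \<in> E"
    then consider i j where "i \<in> {1..n}" "j \<in> {1..m}" "e = {Xi i, Zeta j}"
      | i k where "i \<in> {1..n}" "k \<in> {1..p i}" "e = {Xi i, Av i k}"
      | j k where "j \<in> {1..m}" "k \<in> {1..q j}"
          "e = {Zeta j, Bv j k} \<or> e = {Zeta j, Cv j k} \<or> e = {Bv j k, Cv j k}"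
      unfolding cw_edges_def by auto
    then show "e \<inter> C \<noteq> {}"
    proof cases
      case 1 then show ?thesis using bip by blast
    next
      case 2 then show ?thesis using leaf by blast
    next
      case 3 then show ?thesis using tri by blast
    qed
  qed (rule sub)
  moreover have "\<exists>e\<in>E. e \<inter> C = {v}" if v: "v \<in> C" for v
  proof -
    have private_edge: "\<exists>e\<in>E. e \<inter> C = {v}" if "e \<in> E" "e = {v, w} \<or> e = {w, v}" "w \<notin> C" for e w
      using that v by (intro bexI[of _ e]) auto
    have "v \<in> V"
      using v sub by blast
    show ?thesis
    proof (cases v)
      case (Av i k)
      with \<open>v \<in> V\<close> have ik: "i \<in> {1..n}" "k \<in> {1..p i}" by auto
      show ?thesis
        by (rule private_edge[OF cw_edgesI(2)[OF ik], of "Xi i"])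
          (use leaf[rule_format, OF ik] v Av in auto)
    next
      case (Bv j k)
      with \<open>v \<in> V\<close> have jk: "j \<in> {1..m}" "k \<in> {1..q j}" by auto
      show ?thesis
      proof (cases "Zeta j \<in> C")
        case True
        then show ?thesis
          using private_edge[OF cw_edgesI(5)[OF jk], of "Cv j k"] tri[rule_format, OF jk] v Bv
          by simp
      next
        case False
        then show ?thesis
          using private_edge[OF cw_edgesI(3)[OF jk], of "Zeta j"] Bv by simp
      qed
    next
      case (Cv j k)
      with \<open>v \<in> V\<close> have jk: "j \<in> {1..m}" "k \<in> {1..q j}" by auto
      show ?thesis
      proof (cases "Zeta j \<in> C")
        case True
        then show ?thesis
          using private_edge[OF cw_edgesI(5)[OF jk], of "Bv j k"] tri[rule_format, OF jk] v Cv
          by simp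
      next
        case False
        then show ?thesis
          using private_edge[OF cw_edgesI(4)[OF jk], of "Zeta j"] Cv by simp
      qed
    next
      case (Zeta j)
      with \<open>v \<in> V\<close> have j: "j \<in> {1..m}" by auto
      show ?thesis
      proof (cases "q j = 0")
        case True
        then obtain i where i: "i \<in> {1..n}" "Xi i \<notin> C"
          using zeta j v Zeta by blast
        then show ?thesis
          using private_edge[OF cw_edgesI(1)[OF i(1) j], of "Xi i"] Zeta by simp
      next
        case False
        then have k: "1 \<in> {1..q j}" by simp
        have "Bv j 1 \<notin> C \<or> Cv j 1 \<notin> C"
          using tri[rule_format, OF j k] v Zeta by simp
        then show ?thesis
          using private_edge[OF cw_edgesI(3)[OF j k], of "Bv j 1"]
            private_edge[OF cw_edgesI(4)[OF j k], of "Cv j 1"] Zeta by blast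
      qed
    next
      case (Xi i)
      with \<open>v \<in> V\<close> have i: "i \<in> {1..n}" by auto
      then have k: "1 \<in> {1..p i}"
        using p_pos by auto
      show ?thesis
        by (rule private_edge[OF cw_edgesI(2)[OF i k], of "Av i 1"])
          (use leaf[rule_format, OF i k] v Xi in auto)
    qed (use \<open>v \<in> V\<close> in auto)
  qed
  ultimately show "minimal_vertex_cover V E C"
    by (simp add: minimal_vertex_cover_iff_private_edge)
qed

text \<open>
  Adding or removing one \<open>\<xi>\<^sub>i\<close>, turning over one pendant triangle, and adding or removing one \<open>\<zeta>\<^sub>j\<close>
  are the changes of one component of a cover.  When the last absent \<open>\<xi>\<^sub>i\<close> is added, every \<open>\<zeta>\<^sub>j\<close>
  without triangles has to leave.  When \<open>\<zeta>\<^sub>j\<close> is added, \<open>K\<close> collects the triangles in which \<open>b\<close> is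
  kept.
\<close>

lemma minimal_vertex_cover_insert_Xi:
  assumes "minimal_vertex_cover V E C" and "i \<in> {1..n}" and "Xi i \<notin> C"
  shows "minimal_vertex_cover V E (insert (Xi i) (C - range (Av i) -
    {Zeta j | j. q j = 0 \<and> (\<forall>i'\<in>{1..n} - {i}. Xi i' \<in> C)}))"
  using assms unfolding minimal_vertex_cover_cw_iff by auto

lemma minimal_vertex_cover_remove_Xi:
  assumes "minimal_vertex_cover V E C" and "i \<in> {1..n}" and "Xi i \<in> C"
    and "\<exists>i'\<in>{1..n}. Xi i' \<notin> C"
  shows "minimal_vertex_cover V E (C - {Xi i} \<union> Av i ` {1..p i})"
  using assms unfolding minimal_vertex_cover_cw_iff by auto

lemma minimal_vertex_cover_Bv_to_Cv:
  assumes "minimal_vertex_cover V E C" and "Zeta j \<in> C" and "Bv j k \<in> C"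
  shows "minimal_vertex_cover V E (insert (Cv j k) (C - {Bv j k}))"
  using assms unfolding minimal_vertex_cover_cw_iff by auto

lemma minimal_vertex_cover_Cv_to_Bv:
  assumes "minimal_vertex_cover V E C" and "Zeta j \<in> C" and "Cv j k \<in> C"
  shows "minimal_vertex_cover V E (insert (Bv j k) (C - {Cv j k}))"
  using assms unfolding minimal_vertex_cover_cw_iff by auto

lemma minimal_vertex_cover_insert_Zeta:
  assumes "minimal_vertex_cover V E C" and "j \<in> {1..m}" and "Zeta j \<notin> C" and "q j > 0"
  shows "minimal_vertex_cover V E (insert (Zeta j) (C - Cv j ` K - Bv j ` (- K)))"
  using assms unfolding minimal_vertex_cover_cw_iff by auto

lemma minimal_vertex_cover_remove_Zeta:
  assumes "minimal_vertex_cover V E C" and "j \<in> {1..m}" and "\<forall>i\<in>{1..n}. Xi i \<in> C"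
  shows "minimal_vertex_cover V E (C - {Zeta j} \<union> Bv j ` {1..q j} \<union> Cv j ` {1..q j})"
  using assms unfolding minimal_vertex_cover_cw_iff by auto

end

section \<open>The quadratic monomials are initial\<close>

lemma mdeg_eq_sum:
  assumes "finite F" and "Poly_Mapping.keys \<mu> \<subseteq> F"
  shows "mdeg \<mu> = sum (Poly_Mapping.lookup \<mu>) F"
  unfolding mdeg_def by (rule sum.mono_neutral_left) (use assms in \<open>auto simp: in_keys_iff\<close>)

lemma mdeg_var [simp]: "mdeg (var x) = 1"
  by (simp add: mdeg_def lookup_var)

lemma mdeg_add: "mdeg (\<mu> + \<nu>) = mdeg \<mu> + mdeg \<nu>"
  using mdeg_eq_sum[of "Poly_Mapping.keys \<mu> \<union> Poly_Mapping.keys \<nu>" "\<mu> + \<nu>"]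
    mdeg_eq_sum[of "Poly_Mapping.keys \<mu> \<union> Poly_Mapping.keys \<nu>" \<mu>]
    mdeg_eq_sum[of "Poly_Mapping.keys \<mu> \<union> Poly_Mapping.keys \<nu>" \<nu>]
  by (simp add: keys_add_nat lookup_add sum.distrib)

lemma rees_exp_S:
  assumes "\<mu> \<in> monomials V" and "V \<inter> range Yv = {}"
  shows "rees_exp u \<mu> = \<mu>"
proof (rule poly_mapping_eqI)
  fix v
  have "rees_var u x = var x" if "x \<in> Poly_Mapping.keys \<mu>" for x
    using assms that by (cases x) (auto simp: rees_var_def monomials_def)
  then have "Poly_Mapping.lookup (rees_exp u \<mu>) v =
      (\<Sum>x\<in>Poly_Mapping.keys \<mu>. if x = v then Poly_Mapping.lookup \<mu> v else 0)"
    unfolding lookup_rees_exp[OF finite_keys subset_refl]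
    by (intro sum.cong) (auto simp: lookup_var)
  then show "Poly_Mapping.lookup (rees_exp u \<mu>) v = Poly_Mapping.lookup \<mu> v"
    by (simp add: in_keys_iff)
qed

text \<open>
  The largest index in \<open>\<sigma>'\<close> is at least \<open>a\<close>, hence beyond \<open>\<sigma>\<close>, and it decides the comparison.
\<close>

lemma revlex_less_larger_index:
  assumes deg: "mdeg \<sigma>' = mdeg \<sigma>" and a: "Yv a \<in> Poly_Mapping.keys \<sigma>'"
    and \<sigma>': "\<sigma>' \<in> monomials (Yv ` {1..s})" and \<sigma>: "Poly_Mapping.keys \<sigma> \<subseteq> Yv ` {..<a}"
  shows "revlex_less (map Yv [1..<Suc s]) \<sigma>' \<sigma>"
proof -
  define b where "b = Max {r \<in> {1..s}. Yv r \<in> Poly_Mapping.keys \<sigma>'}"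
  have range: "r \<in> {1..s}" if "Yv r \<in> Poly_Mapping.keys \<sigma>'" for r
    using \<sigma>' that by (auto simp: monomials_def)
  have "b \<in> {r \<in> {1..s}. Yv r \<in> Poly_Mapping.keys \<sigma>'}"
    unfolding b_def by (rule Max_in) (use a range in auto)
  then have b: "b \<in> {1..s}" "Yv b \<in> Poly_Mapping.keys \<sigma>'" by auto
  have b_max: "r \<le> b" if "Yv r \<in> Poly_Mapping.keys \<sigma>'" for r
    unfolding b_def by (rule Max_ge) (use that range in auto)
  have "a \<le> b"
    using a by (rule b_max)
  then have zero: "Poly_Mapping.lookup \<sigma> (Yv r) = 0" if "b \<le> r" for r
    using \<sigma> that by (force simp flip: not_in_keys_iff_lookup_eq_zero)
  have zero': "Poly_Mapping.lookup \<sigma>' (Yv r) = 0" if "b < r" for r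
    using b_max[of r] that by (force simp flip: not_in_keys_iff_lookup_eq_zero)
  have nth: "map Yv [1..<Suc s] ! i = Yv (Suc i)" if "i < s" for i
    using that by (simp del: upt_Suc)
  show ?thesis
    unfolding revlex_less_def
  proof (intro disjI2 conjI exI[of _ "b - 1"] allI impI)
    show "b - 1 < length (map Yv [1..<Suc s])"
      using b by auto
    show "Poly_Mapping.lookup \<sigma> (map Yv [1..<Suc s] ! (b - 1)) <
        Poly_Mapping.lookup \<sigma>' (map Yv [1..<Suc s] ! (b - 1))"
      using b nth[of "b - 1"] zero[of b] by (auto simp: in_keys_iff)
    fix i assume "b - 1 < i \<and> i < length (map Yv [1..<Suc s])"
    then have "i < s" "b < Suc i"
      using b by auto
    then show "Poly_Mapping.lookup \<sigma>' (map Yv [1..<Suc s] ! i) =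
        Poly_Mapping.lookup \<sigma> (map Yv [1..<Suc s] ! i)"
      using nth[of i] zero[of "Suc i"] zero'[of "Suc i"] by (simp del: upt_Suc)
  qed (rule deg)
qed

locale cameron_walker_rees = cameron_walker +
  fixes s :: nat and u :: "nat \<Rightarrow> (indet \<Rightarrow>\<^sub>0 nat)"
  assumes gens: "u ` {1..s} = cover_mon ` {C. minimal_vertex_cover V E C}"
    and decreasing: "r \<in> {1..s} \<Longrightarrow> r' \<in> {1..s} \<Longrightarrow> r < r' \<Longrightarrow>
      lex_less (cw_vertex_list n m p q) (u r') (u r)"
begin

abbreviation cover :: "nat \<Rightarrow> indet set"
  where "cover r \<equiv> Poly_Mapping.keys (u r)"

lemma cover_minimal:
  assumes "r \<in> {1..s}"
  shows "minimal_vertex_cover V E (cover r)" and "u r = cover_mon (cover r)"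
proof -
  obtain C where C: "minimal_vertex_cover V E C" "u r = cover_mon C"
    using assms gens by (metis (mono_tags, lifting) imageE image_eqI mem_Collect_eq)
  then have "finite C"
    using finite_V minimal_vertex_cover_finite by blast
  with C show "minimal_vertex_cover V E (cover r)" "u r = cover_mon (cover r)"
    by simp_all
qed

lemma cover_sub: "r \<in> {1..s} \<Longrightarrow> cover r \<subseteq> V"
  using cover_minimal(1) unfolding minimal_vertex_cover_cw_iff by blast

lemma
  assumes "r \<in> {1..s}"
  shows cover_Av_iff: "\<lbrakk>i \<in> {1..n}; k \<in> {1..p i}\<rbrakk> \<Longrightarrow> Av i k \<in> cover r \<longleftrightarrow> Xi i \<notin> cover r"
    and cover_Xi_Zeta: "\<lbrakk>i \<in> {1..n}; j \<in> {1..m}\<rbrakk> \<Longrightarrow> Xi i \<in> cover r \<or> Zeta j \<in> cover r"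
    and cover_triangle: "\<lbrakk>j \<in> {1..m}; k \<in> {1..q j}; Zeta j \<in> cover r\<rbrakk>
      \<Longrightarrow> Bv j k \<in> cover r \<longleftrightarrow> Cv j k \<notin> cover r"
    and cover_triangle_base: "\<lbrakk>j \<in> {1..m}; k \<in> {1..q j}; Zeta j \<notin> cover r\<rbrakk>
      \<Longrightarrow> Bv j k \<in> cover r \<and> Cv j k \<in> cover r"
    and cover_lone_Zeta: "\<lbrakk>\<forall>i\<in>{1..n}. Xi i \<in> cover r; j \<in> {1..m}; q j = 0\<rbrakk>
      \<Longrightarrow> Zeta j \<notin> cover r"
  using cover_minimal(1)[OF assms] unfolding minimal_vertex_cover_cw_iff by blast+

lemma lookup_u: "r \<in> {1..s} \<Longrightarrow> Poly_Mapping.lookup (u r) v = of_bool (v \<in> cover r)"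
  by (metis cover_minimal(2) finite_keys lookup_cover_mon)

lemma obtain_index:
  assumes "minimal_vertex_cover V E C"
  obtains r where "r \<in> {1..s}" "cover r = C"
proof -
  have "cover_mon C \<in> u ` {1..s}"
    using assms gens by blast
  then obtain r where r: "r \<in> {1..s}" "u r = cover_mon C"
    by (metis imageE)
  moreover have "finite C"
    using assms finite_V minimal_vertex_cover_finite by blast
  ultimately show thesis
    using that[of r] by simp
qed

text \<open>
  To show that a modified cover has a larger index it suffices to exhibit a prefix of the vertex
  list on which vertices are only lost, and one that is.
\<close>

lemma index_less:
  assumes r: "r \<in> {1..s}" and a: "a \<in> {1..s}" and list: "cw_vertex_list n m p q = ys @ zs"
    and w: "w \<in> set ys" "w \<in> cover r" "w \<notin> cover a" and le: "cover a \<inter> set ys \<subseteq> cover r"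
  shows "r < a"
proof -
  have "lex_less (cw_vertex_list n m p q) (u a) (u r)"
    by (rule lex_lessI[OF list w(1)]) (use r a w le in \<open>auto simp: lookup_u\<close>)
  then show ?thesis
    using decreasing[OF a r] lex_less_asym by (metis linorder_neqE_nat)
qed

text \<open>
  By \<open>initial_mons_rees_ideal\<close> these are the initial monomials of the members of the ideal.
\<close>

definition nonminimal :: "(indet \<Rightarrow>\<^sub>0 nat) \<Rightarrow> bool"
  where "nonminimal \<mu> \<longleftrightarrow> \<mu> \<in> monomials (T_indets V s) \<and>
    (\<exists>\<nu>\<in>monomials (T_indets V s). \<nu> \<noteq> \<mu> \<and> rees_exp u \<nu> = rees_exp u \<mu> \<and>
       cw_T_less n m p q s \<nu> \<mu>)"

lemma S_T_monomials:
  "\<rho> \<in> monomials V \<Longrightarrow> \<sigma> \<in> monomials (Yv ` {1..s}) \<Longrightarrow> \<rho> + \<sigma> \<in> monomials (T_indets V s)"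
  by (auto simp: monomials_def T_indets_def keys_add_nat)

text \<open>
  The \<open>y\<close>-parts alone decide the comparison, so the only requirement on the \<open>S\<close>-part \<open>\<rho>'\<close> is that
  it make the images equal.
\<close>

lemma nonminimalI:
  assumes \<rho>: "\<rho> \<in> monomials V" "\<rho>' \<in> monomials V"
    and \<sigma>: "\<sigma> \<in> monomials (Yv ` {1..s})" "\<sigma>' \<in> monomials (Yv ` {1..s})"
    and image: "\<rho>' + rees_exp u \<sigma>' = \<rho> + rees_exp u \<sigma>"
    and deg: "mdeg \<sigma>' = mdeg \<sigma>" and a: "Yv a \<in> Poly_Mapping.keys \<sigma>'"
    and less: "Poly_Mapping.keys \<sigma> \<subseteq> Yv ` {..<a}"
  shows "nonminimal (\<rho> + \<sigma>)"
  unfolding nonminimal_def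
proof (intro conjI bexI[of _ "\<rho>' + \<sigma>'"])
  have V_Y: "V \<inter> range Yv = {}" by auto
  have "Yv a \<in> Poly_Mapping.keys (\<rho>' + \<sigma>')" "Yv a \<notin> Poly_Mapping.keys (\<rho> + \<sigma>)"
    using a less \<rho> by (auto simp: keys_add_nat monomials_def)
  then show "\<rho>' + \<sigma>' \<noteq> \<rho> + \<sigma>" by auto
  show "rees_exp u (\<rho>' + \<sigma>') = rees_exp u (\<rho> + \<sigma>)"
    using image by (simp add: rees_exp_add rees_exp_S[OF \<rho>(1) V_Y] rees_exp_S[OF \<rho>(2) V_Y])
  have set_ys: "set (map Yv [1..<Suc s]) = Yv ` {1..s}"
    by (auto simp del: upt_Suc)
  have "revlex_less (map Yv [1..<Suc s]) \<sigma>' \<sigma>"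
    using deg a \<sigma>(2) less by (rule revlex_less_larger_index)
  then show "cw_T_less n m p q s (\<rho>' + \<sigma>') (\<rho> + \<sigma>)"
    unfolding cw_T_less_def prod_less_def set_ys set_cw_vertex_list using \<rho> \<sigma> by blast
qed (use \<rho> \<sigma> S_T_monomials in auto)

lemma rees_exp_Yv: "rees_exp u (var (Yv r)) = u r + var Tv"
  by (simp add: rees_exp_var rees_var_def)

text \<open>
  The inclusion makes \<open>x u\<^sub>r\<close> a multiple of \<open>u\<^sub>a\<close>, and the quotient becomes the coefficient of \<open>y\<^sub>a\<close> in
  the smaller monomial.
\<close>

lemma nonminimal_var_Yv:
  assumes x: "x \<in> V" and r: "r \<in> {1..s}" and a: "a \<in> {1..s}" and "r < a"
    and sub: "cover a \<subseteq> insert x (cover r)"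
  shows "nonminimal (var x + var (Yv r))"
proof -
  have "u a mdvd var x + u r"
    using sub r a by (auto simp: mdvd_iff_lookup_le lookup_add lookup_var lookup_u)
  then obtain \<rho> where \<rho>: "var x + u r = u a + \<rho>"
    unfolding mdvd_def by blast
  moreover have "var x + u r \<in> monomials V"
    using x cover_sub[OF r] by (auto simp: monomials_def keys_add_nat)
  ultimately have "\<rho> \<in> monomials V"
    by (simp add: monomials_add_iff)
  then show ?thesis
    by (rule nonminimalI[where \<sigma>' = "var (Yv a)" and a = a, rotated])
      (use assms \<rho> in \<open>auto simp: var_in_monomials rees_exp_Yv algebra_simps\<close>)
qed

text \<open>
  The two inclusions say that the covers with indices \<open>a\<close> and \<open>b\<close> are contained, as multisets, in
  those with indices \<open>r\<^sub>0\<close> and \<open>r\<^sub>1\<close>.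
\<close>

lemma nonminimal_Yv_Yv:
  assumes r: "r\<^sub>0 \<in> {1..s}" "r\<^sub>1 \<in> {1..s}" "r\<^sub>1 < r\<^sub>0" and ab: "a \<in> {1..s}" "b \<in> {1..s}" "r\<^sub>0 < a"
    and sub: "cover a \<union> cover b \<subseteq> cover r\<^sub>0 \<union> cover r\<^sub>1"
      "cover a \<inter> cover b \<subseteq> cover r\<^sub>0 \<inter> cover r\<^sub>1"
  shows "nonminimal (var (Yv r\<^sub>0) + var (Yv r\<^sub>1))"
proof -
  have "Poly_Mapping.lookup (u a + u b) v \<le> Poly_Mapping.lookup (u r\<^sub>0 + u r\<^sub>1) v" for v
    using sub r ab by (auto simp: lookup_add lookup_u)
  then obtain \<rho> where \<rho>: "u r\<^sub>0 + u r\<^sub>1 = u a + u b + \<rho>"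
    using mdvd_iff_lookup_le mdvd_def by metis
  moreover have "u r\<^sub>0 + u r\<^sub>1 \<in> monomials V"
    using cover_sub r by (auto simp: monomials_def keys_add_nat)
  ultimately have \<rho>_S: "\<rho> \<in> monomials V"
    by (simp add: monomials_add_iff)
  have "nonminimal (0 + (var (Yv r\<^sub>0) + var (Yv r\<^sub>1)))"
  proof (rule nonminimalI[OF zero_in_monomials \<rho>_S])
    show "\<rho> + rees_exp u (var (Yv a) + var (Yv b)) =
        0 + rees_exp u (var (Yv r\<^sub>0) + var (Yv r\<^sub>1))"
      using \<rho> by (simp add: rees_exp_add rees_exp_Yv algebra_simps)
    show "Yv a \<in> Poly_Mapping.keys (var (Yv a) + var (Yv b))"
      by (simp add: keys_add_nat)
  qed (use r ab in \<open>auto simp: var_in_monomials monomials_add_iff mdeg_add keys_add_nat\<close>)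
  then show ?thesis by simp
qed

text \<open>
  In each of the following cases the modified cover loses a leaf \<open>a\<close>, or an outer triangle vertex,
  that precedes everything it gains: \<open>\<xi>\<^sub>i\<close> and \<open>\<zeta>\<^sub>j\<close> come after all leaves and triangles, and
  \<open>c\<^sub>j\<^sup>k\<close> comes after \<open>b\<^sub>j\<^sup>k\<close>.
\<close>

lemma nonminimal_Xi_Yv:
  assumes i: "i \<in> {1..n}" and r: "r \<in> {1..s}" and "Xi i \<notin> cover r"
  shows "nonminimal (var (Xi i) + var (Yv r))"
proof -
  obtain a where a: "a \<in> {1..s}" and cover_a: "cover a = insert (Xi i) (cover r - range (Av i) -
      {Zeta j | j. q j = 0 \<and> (\<forall>i'\<in>{1..n} - {i}. Xi i' \<in> cover r)})"
    by (rule obtain_index[OF minimal_vertex_cover_insert_Xi[OF cover_minimal(1)[OF r] assms(1,3)]])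
  obtain as bcs rest where list: "cw_vertex_list n m p q = as @ bcs @ rest"
    and as: "set as = {Av i k | i k. i \<in> {1..n} \<and> k \<in> {1..p i}}"
    by (rule cw_vertex_list_prefixes)
  have p: "1 \<in> {1..p i}"
    using p_pos[OF i] by simp
  moreover have "Av i 1 \<in> cover r"
    using cover_minimal(1)[OF r] assms p unfolding minimal_vertex_cover_cw_iff by blast
  ultimately have "r < a"
    using i by (intro index_less[OF r a list, of "Av i 1"]) (auto simp: as cover_a)
  then show ?thesis
    using i r a by (intro nonminimal_var_Yv) (auto simp: cover_a)
qed

lemma nonminimal_Zeta_Yv:
  assumes j: "j \<in> {1..m}" and r: "r \<in> {1..s}" and "q j > 0" and "Zeta j \<notin> cover r"
  shows "nonminimal (var (Zeta j) + var (Yv r))"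
proof -
  obtain a where a: "a \<in> {1..s}" and cover_a: "cover a =
      insert (Zeta j) (cover r - Cv j ` UNIV - Bv j ` (- UNIV))"
    by (rule obtain_index[OF minimal_vertex_cover_insert_Zeta[OF cover_minimal(1)[OF r] j assms(4,3)]])
  obtain as bcs rest where list: "cw_vertex_list n m p q = as @ bcs @ rest"
    and as: "set as = {Av i k | i k. i \<in> {1..n} \<and> k \<in> {1..p i}}"
    and bcs: "set bcs = {Bv j k | j k. j \<in> {1..m} \<and> k \<in> {1..q j}} \<union>
      {Cv j k | j k. j \<in> {1..m} \<and> k \<in> {1..q j}}"
    by (rule cw_vertex_list_prefixes)
  have list': "cw_vertex_list n m p q = (as @ bcs) @ rest"
    using list by simp
  have q: "1 \<in> {1..q j}"
    using assms by simp
  moreover have "Cv j 1 \<in> cover r"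
    using cover_minimal(1)[OF r] assms q unfolding minimal_vertex_cover_cw_iff by blast
  ultimately have "r < a"
    using j by (intro index_less[OF r a list', of "Cv j 1"]) (auto simp: as bcs cover_a)
  then show ?thesis
    using j r a by (intro nonminimal_var_Yv) (auto simp: cover_a)
qed

lemma index_less_Bv_to_Cv:
  assumes r: "r \<in> {1..s}" and a: "a \<in> {1..s}" and jk: "j \<in> {1..m}" "k \<in> {1..q j}"
    and "Bv j k \<in> cover r" and cover_a: "cover a = insert (Cv j k) (cover r - {Bv j k})"
  shows "r < a"
proof -
  obtain ys zs where list: "cw_vertex_list n m p q = ys @ zs"
    and ys: "Bv j k \<in> set ys" "Cv j k \<notin> set ys"
    using jk by (rule cw_vertex_list_split_triangle)
  show ?thesis
    by (rule index_less[OF r a list ys(1)]) (use assms ys in auto)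
qed

lemma nonminimal_Cv_Yv:
  assumes jk: "j \<in> {1..m}" "k \<in> {1..q j}" and r: "r \<in> {1..s}" and c: "Cv j k \<notin> cover r"
  shows "nonminimal (var (Cv j k) + var (Yv r))"
proof -
  have bz: "Zeta j \<in> cover r" "Bv j k \<in> cover r"
    using cover_minimal(1)[OF r] jk c unfolding minimal_vertex_cover_cw_iff by blast+
  obtain a where a: "a \<in> {1..s}" and cover_a: "cover a = insert (Cv j k) (cover r - {Bv j k})"
    by (rule obtain_index[OF minimal_vertex_cover_Bv_to_Cv[OF cover_minimal(1)[OF r] bz]])
  have "r < a"
    using index_less_Bv_to_Cv[OF r a jk bz(2) cover_a] .
  then show ?thesis
    using jk r a by (intro nonminimal_var_Yv) (auto simp: cover_a)
qed

text \<open>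
  The leaf star at \<open>\<xi>\<^sub>i\<close> is exchanged.  Removing \<open>\<xi>\<^sub>i\<close> from the cover of \<open>r\<^sub>1\<close> requires that all
  \<open>\<zeta>\<^sub>j\<close> are there, that is, that some other \<open>\<xi>\<close> is already absent.  This is where \<open>r\<^sub>1 < r\<^sub>0\<close> is
  used: a cover with all \<open>\<xi>\<close> has no leaves, so it would be lexicographically smaller than the
  cover of \<open>r\<^sub>0\<close>.
\<close>

lemma nonminimal_Yv_Yv_Xi:
  assumes r: "r\<^sub>0 \<in> {1..s}" "r\<^sub>1 \<in> {1..s}" "r\<^sub>1 < r\<^sub>0"
    and i: "i \<in> {1..n}" "Xi i \<notin> cover r\<^sub>0" "Xi i \<in> cover r\<^sub>1"
  shows "nonminimal (var (Yv r\<^sub>0) + var (Yv r\<^sub>1))"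
proof -
  note C0 = cover_minimal(1)[OF r(1)] and C1 = cover_minimal(1)[OF r(2)]
  obtain as bcs rest where list: "cw_vertex_list n m p q = as @ bcs @ rest"
    and as: "set as = {Av i k | i k. i \<in> {1..n} \<and> k \<in> {1..p i}}"
    by (rule cw_vertex_list_prefixes)
  have p: "1 \<in> {1..p i}"
    using p_pos[OF i(1)] by simp
  have leaves: "Av i 1 \<in> cover r\<^sub>0" "Av i 1 \<notin> cover r\<^sub>1"
    using C0 C1 i p unfolding minimal_vertex_cover_cw_iff by blast+
  have "\<exists>i'\<in>{1..n}. Xi i' \<notin> cover r\<^sub>1"
  proof (rule ccontr)
    assume no: "\<not> ?thesis"
    have "cover r\<^sub>1 \<inter> set as = {}"
    proof -
      have False if "i' \<in> {1..n}" "k \<in> {1..p i'}" "Av i' k \<in> cover r\<^sub>1" for i' k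
        using C1 no that unfolding minimal_vertex_cover_cw_iff by blast
      then show ?thesis by (auto simp: as)
    qed
    then have "r\<^sub>0 < r\<^sub>1"
      using i p leaves by (intro index_less[OF r(1,2) list, of "Av i 1"]) (auto simp: as)
    with r show False by simp
  qed
  then obtain b where b: "b \<in> {1..s}" and cover_b: "cover b = cover r\<^sub>1 - {Xi i} \<union> Av i ` {1..p i}"
    by (rule obtain_index[OF minimal_vertex_cover_remove_Xi[OF C1 i(1,3)]])
  obtain a where a: "a \<in> {1..s}" and cover_a: "cover a = insert (Xi i) (cover r\<^sub>0 - range (Av i) -
      {Zeta j | j. q j = 0 \<and> (\<forall>i'\<in>{1..n} - {i}. Xi i' \<in> cover r\<^sub>0)})"
    by (rule obtain_index[OF minimal_vertex_cover_insert_Xi[OF C0 i(1,2)]])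
  have "r\<^sub>0 < a"
    using i p leaves by (intro index_less[OF r(1) a list, of "Av i 1"]) (auto simp: as cover_a)
  moreover have "Av i ` {1..p i} \<subseteq> cover r\<^sub>0"
    using C0 i unfolding minimal_vertex_cover_cw_iff by blast
  ultimately show ?thesis
    using r a b i by (intro nonminimal_Yv_Yv[of r\<^sub>0 r\<^sub>1 a b]) (auto simp: cover_a cover_b)
qed

lemma nonminimal_Yv_Yv_triangle:
  assumes r: "r\<^sub>0 \<in> {1..s}" "r\<^sub>1 \<in> {1..s}" "r\<^sub>1 < r\<^sub>0" and jk: "j \<in> {1..m}" "k \<in> {1..q j}"
    and zeta: "Zeta j \<in> cover r\<^sub>0" "Zeta j \<in> cover r\<^sub>1"
    and bc: "Bv j k \<in> cover r\<^sub>0" "Cv j k \<in> cover r\<^sub>1"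
  shows "nonminimal (var (Yv r\<^sub>0) + var (Yv r\<^sub>1))"
proof -
  note C0 = cover_minimal(1)[OF r(1)] and C1 = cover_minimal(1)[OF r(2)]
  obtain a where a: "a \<in> {1..s}" and cover_a: "cover a = insert (Cv j k) (cover r\<^sub>0 - {Bv j k})"
    by (rule obtain_index[OF minimal_vertex_cover_Bv_to_Cv[OF C0 zeta(1) bc(1)]])
  obtain b where b: "b \<in> {1..s}" and cover_b: "cover b = insert (Bv j k) (cover r\<^sub>1 - {Cv j k})"
    by (rule obtain_index[OF minimal_vertex_cover_Cv_to_Bv[OF C1 zeta(2) bc(2)]])
  have "r\<^sub>0 < a"
    using index_less_Bv_to_Cv[OF r(1) a jk bc(1) cover_a] .
  then show ?thesis
    using r a b bc by (intro nonminimal_Yv_Yv[of r\<^sub>0 r\<^sub>1 a b]) (auto simp: cover_a cover_b)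
qed

text \<open>
  All triangles at \<open>\<zeta>\<^sub>j\<close> are exchanged.  The new cover gains \<open>\<zeta>\<^sub>j\<close> and loses one of the outer
  vertices of each of them; there is at least one triangle, since the cover of \<open>r\<^sub>1\<close> contains \<open>\<zeta>\<^sub>j\<close>
  together with all \<open>\<xi>\<close>.
\<close>

lemma nonminimal_Yv_Yv_Zeta:
  assumes r: "r\<^sub>0 \<in> {1..s}" "r\<^sub>1 \<in> {1..s}" "r\<^sub>1 < r\<^sub>0" and j: "j \<in> {1..m}"
    and xi: "\<forall>i\<in>{1..n}. Xi i \<in> cover r\<^sub>0" "\<forall>i\<in>{1..n}. Xi i \<in> cover r\<^sub>1"
    and zeta: "Zeta j \<notin> cover r\<^sub>0" "Zeta j \<in> cover r\<^sub>1"
  shows "nonminimal (var (Yv r\<^sub>0) + var (Yv r\<^sub>1))"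
proof -
  note C0 = cover_minimal(1)[OF r(1)] and C1 = cover_minimal(1)[OF r(2)]
  have q: "q j > 0"
    using C1 xi(2) zeta(2) j unfolding minimal_vertex_cover_cw_iff by blast
  \<comment> \<open>The new cover with \<open>\<zeta>\<^sub>j\<close> inherits its choices at the triangles of \<open>\<zeta>\<^sub>j\<close> from \<open>r\<^sub>1\<close>.\<close>
  define K where "K = {k. Bv j k \<in> cover r\<^sub>1}"
  obtain a where a: "a \<in> {1..s}"
    and cover_a: "cover a = insert (Zeta j) (cover r\<^sub>0 - Cv j ` K - Bv j ` (- K))"
    by (rule obtain_index[OF minimal_vertex_cover_insert_Zeta[OF C0 j zeta(1) q]])
  obtain b where b: "b \<in> {1..s}"
    and cover_b: "cover b = cover r\<^sub>1 - {Zeta j} \<union> Bv j ` {1..q j} \<union> Cv j ` {1..q j}"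
    by (rule obtain_index[OF minimal_vertex_cover_remove_Zeta[OF C1 j xi(2)]])
  obtain as bcs rest where list: "cw_vertex_list n m p q = as @ bcs @ rest"
    and as: "set as = {Av i k | i k. i \<in> {1..n} \<and> k \<in> {1..p i}}"
    and bcs: "set bcs = {Bv j k | j k. j \<in> {1..m} \<and> k \<in> {1..q j}} \<union>
      {Cv j k | j k. j \<in> {1..m} \<and> k \<in> {1..q j}}"
    by (rule cw_vertex_list_prefixes)
  have list': "cw_vertex_list n m p q = (as @ bcs) @ rest"
    using list by simp
  have r0_bc: "Bv j ` {1..q j} \<subseteq> cover r\<^sub>0" "Cv j ` {1..q j} \<subseteq> cover r\<^sub>0"
    using C0 j zeta(1) unfolding minimal_vertex_cover_cw_iff by blast+
  have r1_bc: "Cv j k \<in> cover r\<^sub>1" if "k \<in> {1..q j}" "k \<notin> K" for k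
    using C1 j zeta(2) that unfolding minimal_vertex_cover_cw_iff K_def by blast
  have "Bv j k \<in> cover r\<^sub>1" if "k \<in> K" for k
    using that by (simp add: K_def)
  note r1_bc = r1_bc this
  define w where "w = (if 1 \<in> K then Cv j 1 else Bv j 1)"
  have "r\<^sub>0 < a"
  proof (rule index_less[OF r(1) a list'])
    show "w \<in> set (as @ bcs)" "w \<in> cover r\<^sub>0" "w \<notin> cover a"
      using q j r0_bc by (auto simp: w_def as bcs cover_a)
    show "cover a \<inter> set (as @ bcs) \<subseteq> cover r\<^sub>0"
      by (auto simp: as bcs cover_a)
  qed
  moreover have "cover a \<union> cover b \<subseteq> cover r\<^sub>0 \<union> cover r\<^sub>1"
    using zeta r0_bc by (auto simp: cover_a cover_b)
  moreover have "cover a \<inter> cover b \<subseteq> cover r\<^sub>0 \<inter> cover r\<^sub>1"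
    using zeta r1_bc by (auto simp: cover_a cover_b image_iff)
  ultimately show ?thesis
    using r a b by (intro nonminimal_Yv_Yv)
qed

lemma W_set_nonminimal: "w \<in> W_set n m q s u \<Longrightarrow> nonminimal w"
  unfolding W_set_def var_mdvd_iff
  using nonminimal_Xi_Yv nonminimal_Zeta_Yv nonminimal_Cv_Yv nonminimal_Yv_Yv_Xi
    nonminimal_Yv_Yv_triangle nonminimal_Yv_Yv_Zeta
  by blast

section \<open>Initial monomials are multiples of quadratic ones\<close>

lemma W_setI:
  "\<lbrakk>i \<in> {1..n}; r \<in> {1..s}; Xi i \<notin> cover r\<rbrakk> \<Longrightarrow> var (Xi i) + var (Yv r) \<in> W_set n m q s u"
  "\<lbrakk>j \<in> {1..m}; r \<in> {1..s}; q j > 0; Zeta j \<notin> cover r\<rbrakk>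
     \<Longrightarrow> var (Zeta j) + var (Yv r) \<in> W_set n m q s u"
  "\<lbrakk>j \<in> {1..m}; k \<in> {1..q j}; r \<in> {1..s}; Cv j k \<notin> cover r\<rbrakk>
     \<Longrightarrow> var (Cv j k) + var (Yv r) \<in> W_set n m q s u"
  "\<lbrakk>r\<^sub>0 \<in> {1..s}; r\<^sub>1 \<in> {1..s}; r\<^sub>1 < r\<^sub>0; i \<in> {1..n}; Xi i \<notin> cover r\<^sub>0; Xi i \<in> cover r\<^sub>1\<rbrakk>
     \<Longrightarrow> var (Yv r\<^sub>0) + var (Yv r\<^sub>1) \<in> W_set n m q s u"
  "\<lbrakk>r\<^sub>0 \<in> {1..s}; r\<^sub>1 \<in> {1..s}; r\<^sub>1 < r\<^sub>0; j \<in> {1..m}; k \<in> {1..q j}; Zeta j \<in> cover r\<^sub>0;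
     Zeta j \<in> cover r\<^sub>1; Bv j k \<in> cover r\<^sub>0; Cv j k \<in> cover r\<^sub>1\<rbrakk>
     \<Longrightarrow> var (Yv r\<^sub>0) + var (Yv r\<^sub>1) \<in> W_set n m q s u"
  "\<lbrakk>r\<^sub>0 \<in> {1..s}; r\<^sub>1 \<in> {1..s}; r\<^sub>1 < r\<^sub>0; \<forall>i\<in>{1..n}. Xi i \<in> cover r\<^sub>0;
     \<forall>i\<in>{1..n}. Xi i \<in> cover r\<^sub>1; j \<in> {1..m}; Zeta j \<notin> cover r\<^sub>0; Zeta j \<in> cover r\<^sub>1\<rbrakk>
     \<Longrightarrow> var (Yv r\<^sub>0) + var (Yv r\<^sub>1) \<in> W_set n m q s u"
  unfolding W_set_def var_mdvd_iff
  subgoal by (rule UnI1)+ blast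
  subgoal by (rule UnI1, rule UnI1, rule UnI1, rule UnI1, rule UnI2) blast
  subgoal by (rule UnI1, rule UnI1, rule UnI1, rule UnI2) blast
  subgoal by (rule UnI1, rule UnI1, rule UnI2) blast
  subgoal by (rule UnI1, rule UnI2) blast
  subgoal by (rule UnI2) blast
  done

text \<open>
  The last three facts say that along increasing indices of \<open>y\<close>-variables in \<open>\<mu>\<close> a present \<open>\<xi>\<^sub>i\<close>
  stays present, a triangle at a present \<open>\<zeta>\<^sub>j\<close> never turns from \<open>c\<close> to \<open>b\<close>, and, among covers that
  contain all \<open>\<xi>\<close>, a present \<open>\<zeta>\<^sub>j\<close> stays present.
\<close>

lemma
  assumes free: "\<forall>w\<in>W_set n m q s u. \<not> w mdvd \<mu>"
  shows W_free_Xi: "\<lbrakk>i \<in> {1..n}; r \<in> {1..s}; Yv r \<in> Poly_Mapping.keys \<mu>; Xi i \<notin> cover r\<rbrakk>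
      \<Longrightarrow> Poly_Mapping.lookup \<mu> (Xi i) = 0"
    and W_free_Zeta: "\<lbrakk>j \<in> {1..m}; q j > 0; r \<in> {1..s}; Yv r \<in> Poly_Mapping.keys \<mu>;
        Zeta j \<notin> cover r\<rbrakk> \<Longrightarrow> Poly_Mapping.lookup \<mu> (Zeta j) = 0"
    and W_free_Cv: "\<lbrakk>j \<in> {1..m}; k \<in> {1..q j}; r \<in> {1..s}; Yv r \<in> Poly_Mapping.keys \<mu>;
        Cv j k \<notin> cover r\<rbrakk> \<Longrightarrow> Poly_Mapping.lookup \<mu> (Cv j k) = 0"
    and W_free_Xi_Xi: "\<lbrakk>r\<^sub>0 \<in> {1..s}; r\<^sub>1 \<in> {1..s}; r\<^sub>1 < r\<^sub>0; Yv r\<^sub>0 \<in> Poly_Mapping.keys \<mu>;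
        Yv r\<^sub>1 \<in> Poly_Mapping.keys \<mu>; i \<in> {1..n}; Xi i \<notin> cover r\<^sub>0\<rbrakk> \<Longrightarrow> Xi i \<notin> cover r\<^sub>1"
    and W_free_triangle: "\<lbrakk>r\<^sub>0 \<in> {1..s}; r\<^sub>1 \<in> {1..s}; r\<^sub>1 < r\<^sub>0; Yv r\<^sub>0 \<in> Poly_Mapping.keys \<mu>;
        Yv r\<^sub>1 \<in> Poly_Mapping.keys \<mu>; j \<in> {1..m}; k \<in> {1..q j}; Zeta j \<in> cover r\<^sub>0;
        Zeta j \<in> cover r\<^sub>1; Bv j k \<in> cover r\<^sub>0\<rbrakk> \<Longrightarrow> Cv j k \<notin> cover r\<^sub>1"
    and W_free_Zeta_Zeta: "\<lbrakk>r\<^sub>0 \<in> {1..s}; r\<^sub>1 \<in> {1..s}; r\<^sub>1 < r\<^sub>0; Yv r\<^sub>0 \<in> Poly_Mapping.keys \<mu>;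
        Yv r\<^sub>1 \<in> Poly_Mapping.keys \<mu>; \<forall>i\<in>{1..n}. Xi i \<in> cover r\<^sub>0;
        \<forall>i\<in>{1..n}. Xi i \<in> cover r\<^sub>1; j \<in> {1..m}; Zeta j \<notin> cover r\<^sub>0\<rbrakk> \<Longrightarrow> Zeta j \<notin> cover r\<^sub>1"
proof -
  have no_pair: "False" if "var x + var y \<in> W_set n m q s u" "x \<in> Poly_Mapping.keys \<mu>"
    "y \<in> Poly_Mapping.keys \<mu>" "x \<noteq> y" for x y
    using free that(1) var_add_var_mdvd[OF that(2-4)] by blast
  show "Poly_Mapping.lookup \<mu> (Xi i) = 0"
    if "i \<in> {1..n}" "r \<in> {1..s}" "Yv r \<in> Poly_Mapping.keys \<mu>" "Xi i \<notin> cover r"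
  proof (rule ccontr)
    assume "Poly_Mapping.lookup \<mu> (Xi i) \<noteq> 0"
    then have "Xi i \<in> Poly_Mapping.keys \<mu>"
      by (simp add: in_keys_iff)
    moreover have "var (Xi i) + var (Yv r) \<in> W_set n m q s u"
      using that W_setI(1) by blast
    ultimately show False
      using no_pair that(3) by blast
  qed
  show "Poly_Mapping.lookup \<mu> (Zeta j) = 0"
    if "j \<in> {1..m}" "q j > 0" "r \<in> {1..s}" "Yv r \<in> Poly_Mapping.keys \<mu>" "Zeta j \<notin> cover r"
  proof (rule ccontr)
    assume "Poly_Mapping.lookup \<mu> (Zeta j) \<noteq> 0"
    then have "Zeta j \<in> Poly_Mapping.keys \<mu>"
      by (simp add: in_keys_iff)
    moreover have "var (Zeta j) + var (Yv r) \<in> W_set n m q s u"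
      using that W_setI(2) by blast
    ultimately show False
      using no_pair that(4) by blast
  qed
  show "Poly_Mapping.lookup \<mu> (Cv j k) = 0"
    if "j \<in> {1..m}" "k \<in> {1..q j}" "r \<in> {1..s}" "Yv r \<in> Poly_Mapping.keys \<mu>" "Cv j k \<notin> cover r"
  proof (rule ccontr)
    assume "Poly_Mapping.lookup \<mu> (Cv j k) \<noteq> 0"
    then have "Cv j k \<in> Poly_Mapping.keys \<mu>"
      by (simp add: in_keys_iff)
    moreover have "var (Cv j k) + var (Yv r) \<in> W_set n m q s u"
      using that W_setI(3) by blast
    ultimately show False
      using no_pair that(4) by blast
  qed
  show "Xi i \<notin> cover r\<^sub>1"
    if "r\<^sub>0 \<in> {1..s}" "r\<^sub>1 \<in> {1..s}" "r\<^sub>1 < r\<^sub>0" "Yv r\<^sub>0 \<in> Poly_Mapping.keys \<mu>"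
      "Yv r\<^sub>1 \<in> Poly_Mapping.keys \<mu>" "i \<in> {1..n}" "Xi i \<notin> cover r\<^sub>0"
  proof
    assume "Xi i \<in> cover r\<^sub>1"
    with that have "var (Yv r\<^sub>0) + var (Yv r\<^sub>1) \<in> W_set n m q s u"
      by (intro W_setI(4))
    then show False
      using no_pair[of "Yv r\<^sub>0" "Yv r\<^sub>1"] that by simp
  qed
  show "Cv j k \<notin> cover r\<^sub>1"
    if "r\<^sub>0 \<in> {1..s}" "r\<^sub>1 \<in> {1..s}" "r\<^sub>1 < r\<^sub>0" "Yv r\<^sub>0 \<in> Poly_Mapping.keys \<mu>"
      "Yv r\<^sub>1 \<in> Poly_Mapping.keys \<mu>" "j \<in> {1..m}" "k \<in> {1..q j}" "Zeta j \<in> cover r\<^sub>0"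
      "Zeta j \<in> cover r\<^sub>1" "Bv j k \<in> cover r\<^sub>0"
  proof
    assume "Cv j k \<in> cover r\<^sub>1"
    with that have "var (Yv r\<^sub>0) + var (Yv r\<^sub>1) \<in> W_set n m q s u"
      by (intro W_setI(5))
    then show False
      using no_pair[of "Yv r\<^sub>0" "Yv r\<^sub>1"] that by simp
  qed
  show "Zeta j \<notin> cover r\<^sub>1"
    if "r\<^sub>0 \<in> {1..s}" "r\<^sub>1 \<in> {1..s}" "r\<^sub>1 < r\<^sub>0" "Yv r\<^sub>0 \<in> Poly_Mapping.keys \<mu>"
      "Yv r\<^sub>1 \<in> Poly_Mapping.keys \<mu>" "\<forall>i\<in>{1..n}. Xi i \<in> cover r\<^sub>0"
      "\<forall>i\<in>{1..n}. Xi i \<in> cover r\<^sub>1" "j \<in> {1..m}" "Zeta j \<notin> cover r\<^sub>0"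
  proof
    assume "Zeta j \<in> cover r\<^sub>1"
    with that have "var (Yv r\<^sub>0) + var (Yv r\<^sub>1) \<in> W_set n m q s u"
      by (intro W_setI(6))
    then show False
      using no_pair[of "Yv r\<^sub>0" "Yv r\<^sub>1"] that by simp
  qed
qed

text \<open>
  Here \<open>A\<close> and \<open>B\<close> are the exponents of the \<open>y\<close>-parts of \<open>\<mu>\<close> and \<open>\<nu>\<close> after cancellation.  With \<open>l\<close>
  the largest index of \<open>A\<close>, the covers of \<open>l\<close> and \<open>r'\<close> are compared at the first vertex \<open>v\<close> where
  they differ, which belongs to the cover of \<open>l\<close> since \<open>l < r'\<close>.  If \<open>v\<close> is a leaf, then \<open>l\<close> misses
  a \<open>\<xi>\<^sub>i\<close> that \<open>r'\<close> contains.  If \<open>v\<close> is an outer triangle vertex, then either \<open>r'\<close> contains a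
  \<open>\<zeta>\<^sub>j\<close> that \<open>l\<close> misses, or \<open>r'\<close> has turned a triangle from \<open>b\<close> to \<open>c\<close>.  The vertices of these two
  kinds determine the rest of a cover.  Each case is refuted by counting: monotonicity makes the
  number of occurrences of a vertex in the covers of \<open>A\<close> extremal, whereas \<open>r'\<close> contributes an
  occurrence too many to \<open>B\<close>.
\<close>

lemma W_free_no_smaller_preimage:
  fixes A B :: "nat \<Rightarrow> nat"
  assumes free: "\<forall>w\<in>W_set n m q s u. \<not> w mdvd \<mu>"
    and A: "\<And>r. r \<in> {1..s} \<Longrightarrow> A r > 0 \<Longrightarrow> Yv r \<in> Poly_Mapping.keys \<mu>"
    and image: "\<And>v. v \<in> V \<Longrightarrow>
      Poly_Mapping.lookup \<mu> v + sum A {r \<in> {1..s}. v \<in> cover r} =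
      Poly_Mapping.lookup \<nu> v + sum B {r \<in> {1..s}. v \<in> cover r}"
    and degree: "sum A {1..s} = sum B {1..s}"
    and r': "r' \<in> {1..s}" "B r' > 0"
    and less: "\<And>r. r \<in> {1..s} \<Longrightarrow> A r > 0 \<Longrightarrow> r < r'"
  shows False
proof -
  \<comment> \<open>Numbers of covers with a given property in the two \<open>y\<close>-parts, with multiplicity.\<close>
  define a where "a P = sum A {r \<in> {1..s}. P r}" for P
  define b where "b P = sum B {r \<in> {1..s}. P r}" for P
  note image = image[folded a_def b_def]
  have a_mono: "a P \<le> a Q" if "\<And>r. r \<in> {1..s} \<Longrightarrow> A r > 0 \<Longrightarrow> P r \<Longrightarrow> Q r" for P Q
  proof -
    have "a P = sum A {r \<in> {1..s}. P r \<and> A r > 0}"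
      unfolding a_def by (rule sum.mono_neutral_right) auto
    also have "\<dots> \<le> a Q"
      unfolding a_def by (rule sum_mono2) (use that in auto)
    finally show ?thesis .
  qed
  have b_r': "b P + B r' \<le> b Q" if "\<And>r. r \<in> {1..s} \<Longrightarrow> P r \<Longrightarrow> Q r" "\<not> P r'" "Q r'" for P Q
  proof -
    have "b P + B r' = sum B (insert r' {r \<in> {1..s}. P r})"
      unfolding b_def using that by (subst sum.insert) auto
    also have "\<dots> \<le> b Q"
      unfolding b_def by (rule sum_mono2) (use that r' in auto)
    finally show ?thesis .
  qed
  have split: "sum F {1..s} = sum F {r \<in> {1..s}. P r} + sum F {r \<in> {1..s}. \<not> P r}"
    for F :: "nat \<Rightarrow> nat" and P
    by (subst sum.union_disjoint[symmetric]) (auto intro: sum.cong)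
  have a_split: "sum A {1..s} = a P + a (\<lambda>r. \<not> P r)" for P
    unfolding a_def by (rule split)
  have b_split: "sum A {1..s} = b P + b (\<lambda>r. \<not> P r)" for P
    unfolding b_def degree by (rule split)
  have b_pos: "B r' \<le> b P" if "P r'" for P
    using b_r'[of "\<lambda>_. False" P] that by simp

  define l where "l = Max {r \<in> {1..s}. A r > 0}"
  have "B r' \<le> sum B {1..s}"
    using r' by (intro member_le_sum) auto
  then have "sum A {1..s} \<noteq> 0"
    using degree r'(2) by linarith
  then have "{r \<in> {1..s}. A r > 0} \<noteq> {}"
    by auto
  then have "l \<in> {r \<in> {1..s}. A r > 0}"
    unfolding l_def by (intro Max_in) auto
  then have l: "l \<in> {1..s}" "A l > 0" by auto
  then have l_key: "Yv l \<in> Poly_Mapping.keys \<mu>" and "l < r'"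
    using A less by auto
  have l_max: "r < l" if "r \<in> {1..s}" "A r > 0" "r \<noteq> l" for r
  proof -
    have "r \<le> l" unfolding l_def using that by (intro Max_ge) auto
    with that show ?thesis by simp
  qed
  \<comment> \<open>A \<open>\<xi>\<^sub>i\<close> absent at \<open>l\<close> is absent at all indices of \<open>A\<close> and does not divide \<open>\<mu>\<close>, so its
    exponent in the image is zero.\<close>
  have xi: "Xi i \<notin> cover r'" if i: "i \<in> {1..n}" "Xi i \<notin> cover l" for i
  proof
    assume "Xi i \<in> cover r'"
    then have "B r' \<le> b (\<lambda>r. Xi i \<in> cover r)"
      by (rule b_pos)
    moreover have "a (\<lambda>r. Xi i \<in> cover r) \<le> a (\<lambda>_. False)"
      using W_free_Xi_Xi[OF free l(1)] A l_key l_max i by (intro a_mono) metis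
    moreover have "Poly_Mapping.lookup \<mu> (Xi i) = 0"
      using W_free_Xi[OF free] i l l_key by blast
    ultimately show False
      using image[of "Xi i"] i r' by (simp add: a_def[of "\<lambda>_. False"])
  qed

  obtain as bcs rest where list: "cw_vertex_list n m p q = as @ bcs @ rest"
    and as: "set as = {Av i k | i k. i \<in> {1..n} \<and> k \<in> {1..p i}}"
    and bcs: "set bcs = {Bv j k | j k. j \<in> {1..m} \<and> k \<in> {1..q j}} \<union>
      {Cv j k | j k. j \<in> {1..m} \<and> k \<in> {1..q j}}"
    by (rule cw_vertex_list_prefixes)
  obtain v where v_in: "v \<in> V"
    and v: "Poly_Mapping.lookup (u r') v < Poly_Mapping.lookup (u l) v"
    and before: "\<And>ys zs w. cw_vertex_list n m p q = ys @ zs \<Longrightarrow> v \<notin> set ys \<Longrightarrow> w \<in> set ys \<Longrightarrow>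
      Poly_Mapping.lookup (u r') w = Poly_Mapping.lookup (u l) w"
    using lex_less_first_difference[OF decreasing[OF l(1) r'(1) \<open>l < r'\<close>]]
    unfolding set_cw_vertex_list by metis
  have v_l: "v \<in> cover l" and v_r': "v \<notin> cover r'"
    using v unfolding lookup_u[OF l(1)] lookup_u[OF r'(1)] by (auto simp: of_bool_def split: if_splits)
  have agree: "w \<in> cover r' \<longleftrightarrow> w \<in> cover l"
    if "cw_vertex_list n m p q = ys @ zs" "v \<notin> set ys" "w \<in> set ys" for ys zs w
    using before[OF that] unfolding lookup_u[OF l(1)] lookup_u[OF r'(1)] by (simp only: of_bool_eq_iff)

  have v_not_Av: "v \<notin> set as"
  proof
    assume "v \<in> set as"
    then obtain i k where "i \<in> {1..n}" "k \<in> {1..p i}" "v = Av i k"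
      by (auto simp: as)
    then show False
      using v_l v_r' xi cover_Av_iff[OF l(1)] cover_Av_iff[OF r'(1)] by blast
  qed
  have xi_eq: "Xi i \<in> cover r' \<longleftrightarrow> Xi i \<in> cover l" if i: "i \<in> {1..n}" for i
  proof -
    have p: "1 \<in> {1..p i}"
      using p_pos[OF i] by simp
    have "Av i 1 \<in> cover r' \<longleftrightarrow> Av i 1 \<in> cover l"
      using i p by (intro agree[OF list v_not_Av]) (auto simp: as)
    moreover have "Av i 1 \<in> cover r' \<longleftrightarrow> Xi i \<notin> cover r'" "Av i 1 \<in> cover l \<longleftrightarrow> Xi i \<notin> cover l"
      using cover_Av_iff[OF l(1) i p] cover_Av_iff[OF r'(1) i p] by blast+
    ultimately show ?thesis by blast
  qed

  \<comment> \<open>As \<open>\<zeta>\<^sub>j\<close> is absent at \<open>l\<close>, it occurs in the covers of \<open>A\<close> only where some \<open>\<xi>\<close> is absent.  By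
    monotonicity the \<open>\<xi>\<^sub>i\<close> absent at the last such index \<open>g\<close> is absent at all of them.  The covers
    of \<open>B\<close> miss \<open>\<xi>\<^sub>i\<close> at least as often as those of \<open>A\<close>, which already accounts for the exponent
    of \<open>\<zeta>\<^sub>j\<close>, but \<open>r'\<close> contains \<open>\<zeta>\<^sub>j\<close> as well as \<open>\<xi>\<^sub>i\<close>.\<close>
  have no_new_Zeta: False
    if j: "j \<in> {1..m}" "q j > 0" and zeta: "Zeta j \<notin> cover l" "Zeta j \<in> cover r'" for j
  proof -
    have xi_l: "\<forall>i\<in>{1..n}. Xi i \<in> cover l"
      using cover_Xi_Zeta[OF l(1)] j zeta by blast
    have zeta_bip: "\<exists>i\<in>{1..n}. Xi i \<notin> cover r" if "r \<in> {1..s}" "A r > 0" "Zeta j \<in> cover r" for r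
      using W_free_Zeta_Zeta[OF free l(1) that(1)] that A l_key l_max xi_l j zeta by blast
    have x0: "Poly_Mapping.lookup \<mu> (Zeta j) = 0"
      using W_free_Zeta[OF free] j l l_key zeta by blast
    let ?G = "{r \<in> {1..s}. A r > 0 \<and> (\<exists>i\<in>{1..n}. Xi i \<notin> cover r)}"
    show False
    proof (cases "?G = {}")
      case True
      then have "a (\<lambda>r. Zeta j \<in> cover r) \<le> a (\<lambda>_. False)"
        using zeta_bip by (intro a_mono) blast
      then show False
        using image[of "Zeta j"] x0 b_pos[of "\<lambda>r. Zeta j \<in> cover r"] zeta j r'
        by (simp add: a_def[of "\<lambda>_. False"])
    next
      case False
      define g where "g = Max ?G"
      have "g \<in> ?G"
        unfolding g_def using False by (intro Max_in) auto
      then obtain i where g: "g \<in> {1..s}" "A g > 0" and i: "i \<in> {1..n}" "Xi i \<notin> cover g"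
        by blast
      have "Xi i \<notin> cover r" if "r \<in> {1..s}" "A r > 0" "Zeta j \<in> cover r" for r
      proof (cases "r = g")
        case False
        have "r \<le> g"
          unfolding g_def using that zeta_bip by (intro Max_ge) auto
        with False show ?thesis
          using W_free_Xi_Xi[OF free g(1) that(1)] A g that i by simp
      qed (use i in simp)
      then have "a (\<lambda>r. Zeta j \<in> cover r) \<le> a (\<lambda>r. Xi i \<notin> cover r)"
        by (rule a_mono)
      moreover have "b (\<lambda>r. Xi i \<notin> cover r) + B r' \<le> b (\<lambda>r. Zeta j \<in> cover r)"
      proof (rule b_r')
        show "Zeta j \<in> cover r" if "r \<in> {1..s}" "Xi i \<notin> cover r" for r
          using cover_Xi_Zeta[OF that(1)] that i j by blast
        show "\<not> Xi i \<notin> cover r'"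
          using xi_eq xi_l i by blast
      qed (rule zeta)
      moreover have "Poly_Mapping.lookup \<mu> (Xi i) = 0"
        using W_free_Xi[OF free] i A g by blast
      ultimately show False
        using image[of "Xi i"] image[of "Zeta j"] x0 i j r' a_split[of "\<lambda>r. Xi i \<in> cover r"]
          b_split[of "\<lambda>r. Xi i \<in> cover r"] by simp
    qed
  qed

  \<comment> \<open>By monotonicity \<open>c\<^sub>j\<^sup>k\<close> occurs in the covers of \<open>A\<close> only where \<open>\<zeta>\<^sub>j\<close> is absent, whereas in \<open>B\<close>
    it also occurs at \<open>r'\<close>.  So \<open>\<zeta>\<^sub>j\<close> is absent from more covers of \<open>A\<close> than of \<open>B\<close>, and \<open>\<mu>\<close> has to
    make up for it by containing \<open>\<zeta>\<^sub>j\<close>; but then \<open>\<zeta>\<^sub>j\<close> is absent from no cover of \<open>A\<close>.\<close>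
  have no_turned_triangle: False
    if jk: "j \<in> {1..m}" "k \<in> {1..q j}" and zeta: "Zeta j \<in> cover l" "Zeta j \<in> cover r'"
      and bc: "Bv j k \<in> cover l" "Cv j k \<in> cover r'" for j k
  proof -
    have "Cv j k \<notin> cover l"
      using cover_triangle[OF l(1) jk] zeta bc by blast
    then have "Poly_Mapping.lookup \<mu> (Cv j k) = 0"
      using W_free_Cv[OF free] jk l l_key by blast
    moreover have "a (\<lambda>r. Cv j k \<in> cover r) \<le> a (\<lambda>r. Zeta j \<notin> cover r)"
      using W_free_triangle[OF free l(1)] A l_key l_max jk zeta bc \<open>Cv j k \<notin> cover l\<close>
      by (intro a_mono) metis
    moreover have "b (\<lambda>r. Zeta j \<notin> cover r) + B r' \<le> b (\<lambda>r. Cv j k \<in> cover r)"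
    proof (rule b_r')
      show "Cv j k \<in> cover r" if "r \<in> {1..s}" "Zeta j \<notin> cover r" for r
        using cover_triangle_base[OF that(1) jk] that by blast
    qed (use zeta bc in auto)
    ultimately have less: "b (\<lambda>r. Zeta j \<notin> cover r) < a (\<lambda>r. Zeta j \<notin> cover r)"
      using image[of "Cv j k"] jk r' by simp
    then have "Poly_Mapping.lookup \<mu> (Zeta j) \<noteq> 0"
      using image[of "Zeta j"] jk a_split[of "\<lambda>r. Zeta j \<in> cover r"]
        b_split[of "\<lambda>r. Zeta j \<in> cover r"] by simp
    then have "a (\<lambda>r. Zeta j \<notin> cover r) \<le> a (\<lambda>_. False)"
      using W_free_Zeta[OF free jk(1)] A jk by (intro a_mono) fastforce
    with less show False
      by (simp add: a_def[of "\<lambda>_. False"])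
  qed

  show False
  proof (cases "v \<in> set bcs")
    case True
    then obtain j k where jk: "j \<in> {1..m}" "k \<in> {1..q j}" and v_bc: "v = Bv j k \<or> v = Cv j k"
      by (auto simp: bcs)
    have tri_r': "Zeta j \<in> cover r'" "Bv j k \<in> cover r' \<longleftrightarrow> Cv j k \<notin> cover r'"
      using cover_triangle_base[OF r'(1) jk] cover_triangle[OF r'(1) jk] v_bc v_r' by blast+
    have tri_l: "Zeta j \<in> cover l \<longrightarrow> (Bv j k \<in> cover l \<longleftrightarrow> Cv j k \<notin> cover l)"
      using cover_triangle[OF l(1) jk] by blast
    have "q j > 0"
      using jk by auto
    have zeta_l: "Zeta j \<in> cover l"
      using no_new_Zeta[OF jk(1) \<open>q j > 0\<close>] tri_r' by blast
    obtain ys zs where split: "cw_vertex_list n m p q = ys @ zs" "Bv j k \<in> set ys"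
      "Cv j k \<notin> set ys"
      using jk by (rule cw_vertex_list_split_triangle)
    have "v = Bv j k"
    proof (rule ccontr)
      assume "v \<noteq> Bv j k"
      then have "v = Cv j k"
        using v_bc by blast
      then have "Bv j k \<in> cover r' \<longleftrightarrow> Bv j k \<in> cover l"
        using agree[of ys zs] split by blast
      then show False
        using \<open>v = Cv j k\<close> v_l v_r' tri_r' tri_l zeta_l by blast
    qed
    then show False
      using no_turned_triangle[OF jk zeta_l] tri_r' v_l v_r' by blast
  next
    case False
    have list': "cw_vertex_list n m p q = (as @ bcs) @ rest"
      using list by simp
    have bc_eq: "w \<in> cover r' \<longleftrightarrow> w \<in> cover l" if "w \<in> set bcs" for w
      using False v_not_Av that by (intro agree[OF list']) auto
    show False
    proof (cases v)
      case (Zeta j)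
      then have j: "j \<in> {1..m}"
        using v_in by simp
      show False
      proof (cases "q j = 0")
        case True
        then obtain i where "i \<in> {1..n}" "Xi i \<notin> cover l"
          using cover_lone_Zeta[OF l(1) _ j] v_l Zeta by blast
        then show False
          using cover_Xi_Zeta[OF r'(1) _ j] xi_eq v_r' Zeta by blast
      next
        case q: False
        then have k: "1 \<in> {1..q j}" by simp
        then have "Bv j 1 \<in> set bcs" "Cv j 1 \<in> set bcs"
          using j by (auto simp: bcs)
        then show False
          using cover_triangle[OF l(1) j k] cover_triangle_base[OF r'(1) j k] v_l v_r' Zeta bc_eq
          by blast
      qed
    next
      case (Xi i)
      then show False
        using v_in v_l v_r' xi_eq by simp
    qed (use v_in False v_not_Av in \<open>auto simp: as bcs\<close>)
  qed
qed

lemma rees_var_simps: "x \<in> V \<Longrightarrow> rees_var u x = var x" "rees_var u (Yv r) = u r + var Tv"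
  by (cases x) (auto simp: rees_var_def)

lemma lookup_rees_exp_T_monomial:
  assumes "\<mu> \<in> monomials (T_indets V s)"
  shows "Poly_Mapping.lookup (rees_exp u \<mu>) v =
    (\<Sum>x\<in>V. Poly_Mapping.lookup \<mu> x * of_bool (v = x)) +
    (\<Sum>r\<in>{1..s}. Poly_Mapping.lookup \<mu> (Yv r) * (of_bool (v \<in> cover r) + of_bool (v = Tv)))"
proof -
  have "Poly_Mapping.lookup (rees_exp u \<mu>) v = (\<Sum>x\<in>V \<union> Yv ` {1..s}.
      Poly_Mapping.lookup \<mu> x * Poly_Mapping.lookup (rees_var u x) v)"
    using assms finite_V by (intro lookup_rees_exp) (auto simp: monomials_def T_indets_def)
  also have "\<dots> = (\<Sum>x\<in>V. Poly_Mapping.lookup \<mu> x * Poly_Mapping.lookup (rees_var u x) v) +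
      (\<Sum>x\<in>Yv ` {1..s}. Poly_Mapping.lookup \<mu> x * Poly_Mapping.lookup (rees_var u x) v)"
    using finite_V by (intro sum.union_disjoint) auto
  also have "(\<Sum>x\<in>V. Poly_Mapping.lookup \<mu> x * Poly_Mapping.lookup (rees_var u x) v) =
      (\<Sum>x\<in>V. Poly_Mapping.lookup \<mu> x * of_bool (v = x))"
    by (intro sum.cong) (simp_all add: rees_var_simps lookup_var)
  also have "(\<Sum>x\<in>Yv ` {1..s}. Poly_Mapping.lookup \<mu> x * Poly_Mapping.lookup (rees_var u x) v) =
      (\<Sum>r\<in>{1..s}. Poly_Mapping.lookup \<mu> (Yv r) * (of_bool (v \<in> cover r) + of_bool (v = Tv)))"
    by (subst sum.reindex)
      (auto simp: inj_on_def rees_var_simps lookup_add lookup_var lookup_u intro!: sum.cong)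
  finally show ?thesis .
qed

text \<open>
  Comparing exponents of vertices and of \<open>t\<close> in the two images gives the equations to count with.
\<close>

lemma lookup_rees_exp_vertex:
  assumes "\<mu> \<in> monomials (T_indets V s)" and v: "v \<in> V"
  shows "Poly_Mapping.lookup (rees_exp u \<mu>) v =
    Poly_Mapping.lookup \<mu> v + (\<Sum>r | r \<in> {1..s} \<and> v \<in> cover r. Poly_Mapping.lookup \<mu> (Yv r))"
proof -
  have "v \<noteq> Tv"
    using v by auto
  moreover have "(\<Sum>x\<in>V. Poly_Mapping.lookup \<mu> x * of_bool (v = x)) = Poly_Mapping.lookup \<mu> v"
    using v finite_V by (simp add: of_bool_def if_distrib[of "\<lambda>c. _ * c"] cong: if_cong)
  moreover have "(\<Sum>r\<in>{1..s}. Poly_Mapping.lookup \<mu> (Yv r) * of_bool (v \<in> cover r)) =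
      (\<Sum>r | r \<in> {1..s} \<and> v \<in> cover r. Poly_Mapping.lookup \<mu> (Yv r))"
    by (rule sum.mono_neutral_cong_right) auto
  ultimately show ?thesis
    using assms(1) by (simp add: lookup_rees_exp_T_monomial)
qed

lemma lookup_rees_exp_Tv:
  assumes "\<mu> \<in> monomials (T_indets V s)"
  shows "Poly_Mapping.lookup (rees_exp u \<mu>) Tv = (\<Sum>r\<in>{1..s}. Poly_Mapping.lookup \<mu> (Yv r))"
proof -
  have "Tv \<notin> cover r" if "r \<in> {1..s}" for r
    using cover_sub[OF that] by auto
  then have "(\<Sum>r\<in>{1..s}. Poly_Mapping.lookup \<mu> (Yv r) * (of_bool (Tv \<in> cover r) + of_bool (Tv = Tv))) =
      (\<Sum>r\<in>{1..s}. Poly_Mapping.lookup \<mu> (Yv r))"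
    by (intro sum.cong) auto
  moreover have "(\<Sum>x\<in>V. Poly_Mapping.lookup \<mu> x * of_bool (Tv = x)) = 0"
    by (rule sum.neutral) auto
  ultimately show ?thesis
    by (simp only: lookup_rees_exp_T_monomial[OF assms])
qed

lemma nonminimal_divisible:
  assumes "nonminimal \<mu>"
  shows "\<exists>w\<in>W_set n m q s u. w mdvd \<mu>"
proof (rule ccontr)
  assume "\<not> ?thesis"
  then have free: "\<forall>w\<in>W_set n m q s u. \<not> w mdvd \<mu>" by blast
  obtain \<nu> where \<mu>: "\<mu> \<in> monomials (T_indets V s)" and \<nu>: "\<nu> \<in> monomials (T_indets V s)"
    "\<nu> \<noteq> \<mu>" "rees_exp u \<nu> = rees_exp u \<mu>" and less: "cw_T_less n m p q s \<nu> \<mu>"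
    using assms unfolding nonminimal_def by blast
  define M where "M r = Poly_Mapping.lookup \<mu> (Yv r)" for r
  define N where "N r = Poly_Mapping.lookup \<nu> (Yv r)" for r
  have image: "Poly_Mapping.lookup \<mu> v + sum M {r \<in> {1..s}. v \<in> cover r} =
      Poly_Mapping.lookup \<nu> v + sum N {r \<in> {1..s}. v \<in> cover r}" if "v \<in> V" for v
    using lookup_rees_exp_vertex[OF \<mu> that] lookup_rees_exp_vertex[OF \<nu>(1) that] \<nu>(3)
    by (simp add: M_def N_def)
  have degree: "sum M {1..s} = sum N {1..s}"
    using lookup_rees_exp_Tv[OF \<mu>] lookup_rees_exp_Tv[OF \<nu>(1)] \<nu>(3)
    by (simp add: M_def N_def)
  obtain r' where r': "r' \<in> {1..s}" "M r' < N r'" and later: "\<And>r. r \<in> {1..s} \<Longrightarrow> r' < r \<Longrightarrow> M r = N r"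
  proof -
    have set_ys: "set (map Yv [1..<Suc s]) = Yv ` {1..s}"
      by (auto simp del: upt_Suc)
    obtain \<nu>' \<nu>'' \<mu>' \<mu>'' where S: "\<nu>' \<in> monomials V" "\<mu>' \<in> monomials V"
      and Y: "\<nu>'' \<in> monomials (Yv ` {1..s})" "\<mu>'' \<in> monomials (Yv ` {1..s})"
      and sum: "\<nu> = \<nu>' + \<nu>''" "\<mu> = \<mu>' + \<mu>''"
      and disj: "revlex_less (map Yv [1..<Suc s]) \<nu>'' \<mu>'' \<or>
        \<nu>'' = \<mu>'' \<and> lex_less (cw_vertex_list n m p q) \<nu>' \<mu>'"
      using less unfolding cw_T_less_def prod_less_def set_ys set_cw_vertex_list by blast
    have "Yv r \<notin> Poly_Mapping.keys \<nu>'" "Yv r \<notin> Poly_Mapping.keys \<mu>'" for r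
      using S by (auto simp: monomials_def)
    then have MN: "Poly_Mapping.lookup \<nu>'' (Yv r) = N r" "Poly_Mapping.lookup \<mu>'' (Yv r) = M r" for r
      by (simp_all add: M_def N_def sum lookup_add in_keys_iff)
    have "mdeg \<sigma> = (\<Sum>r\<in>{1..s}. Poly_Mapping.lookup \<sigma> (Yv r))" if "\<sigma> \<in> monomials (Yv ` {1..s})" for \<sigma>
    proof -
      have "mdeg \<sigma> = sum (Poly_Mapping.lookup \<sigma>) (Yv ` {1..s})"
        using that by (intro mdeg_eq_sum) (auto simp: monomials_def)
      then show ?thesis
        by (simp add: sum.reindex inj_on_def)
    qed
    then have mdeg_eq: "mdeg \<nu>'' = mdeg \<mu>''"
      using Y degree by (simp add: MN)
    \<comment> \<open>Equal \<open>y\<close>-parts and equal images would force \<open>\<nu> = \<mu>\<close>.\<close>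
    have "\<nu>'' \<noteq> \<mu>''"
    proof
      assume "\<nu>'' = \<mu>''"
      then have "M r = N r" for r
        using MN by metis
      then have "Poly_Mapping.lookup \<mu> v = Poly_Mapping.lookup \<nu> v" if "v \<in> V" for v
        using image[OF that] by simp
      moreover have "Poly_Mapping.lookup \<mu> v = Poly_Mapping.lookup \<nu> v" if "v \<notin> V" for v
      proof -
        have "Poly_Mapping.lookup \<mu>' v = 0" "Poly_Mapping.lookup \<nu>' v = 0"
          using S that by (auto simp: monomials_def in_keys_iff)
        then show ?thesis
          by (simp add: sum lookup_add \<open>\<nu>'' = \<mu>''\<close>)
      qed
      ultimately have "\<mu> = \<nu>"
        by (intro poly_mapping_eqI) blast
      with \<nu> show False by simp
    qed
    with disj mdeg_eq obtain i where i: "i < s"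
      and less: "Poly_Mapping.lookup \<mu>'' (map Yv [1..<Suc s] ! i) <
        Poly_Mapping.lookup \<nu>'' (map Yv [1..<Suc s] ! i)"
      and eq: "\<And>k. i < k \<Longrightarrow> k < s \<Longrightarrow> Poly_Mapping.lookup \<nu>'' (map Yv [1..<Suc s] ! k) =
        Poly_Mapping.lookup \<mu>'' (map Yv [1..<Suc s] ! k)"
      unfolding revlex_less_def by (auto simp del: upt_Suc)
    have nth: "map Yv [1..<Suc s] ! k = Yv (Suc k)" if "k < s" for k
      using that by (simp del: upt_Suc)
    show thesis
    proof (rule that)
      show "Suc i \<in> {1..s}" using i by simp
      show "M (Suc i) < N (Suc i)"
        using less i by (simp only: nth MN)
      fix r assume "r \<in> {1..s}" "Suc i < r"
      then show "M r = N r"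
        using eq[of "r - 1"] nth[of "r - 1"] by (simp add: MN del: upt_Suc)
    qed
  qed
  \<comment> \<open>Truncated subtraction removes the common \<open>y\<close>-part from both sides.\<close>
  define A where "A r = M r - N r" for r
  define B where "B r = N r - M r" for r
  have AB: "sum M R + sum B R = sum N R + sum A R" for R
    unfolding A_def B_def sum.distrib[symmetric] by (rule sum.cong) auto
  show False
  proof (rule W_free_no_smaller_preimage[OF free, of A \<nu> B r'])
    show "Yv r \<in> Poly_Mapping.keys \<mu>" if "A r > 0" for r
      using that by (simp add: A_def M_def in_keys_iff)
    show "Poly_Mapping.lookup \<mu> v + sum A {r \<in> {1..s}. v \<in> cover r} =
        Poly_Mapping.lookup \<nu> v + sum B {r \<in> {1..s}. v \<in> cover r}" if "v \<in> V" for v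
      using image[OF that] AB[of "{r \<in> {1..s}. v \<in> cover r}"] by linarith
    show "sum A {1..s} = sum B {1..s}"
      using degree AB[of "{1..s}"] by linarith
    show "B r' > 0"
      using r' by (simp add: B_def)
    show "r < r'" if "r \<in> {1..s}" "A r > 0" for r
    proof (rule ccontr)
      assume "\<not> r < r'"
      then have "M r \<le> N r"
        using later[OF that(1)] r' by (cases "r = r'") auto
      with that show False by (simp add: A_def)
    qed
  qed (use r' in auto)
qed

section \<open>The initial ideal\<close>

lemma mdeg_W_set: "w \<in> W_set n m q s u \<Longrightarrow> mdeg w = 2"
  unfolding W_set_def by (auto simp: mdeg_add)

lemma W_set_antichain:
  assumes "\<mu> \<in> W_set n m q s u" and "\<nu> \<in> W_set n m q s u" and "\<mu> mdvd \<nu>"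
  shows "\<mu> = \<nu>"
proof -
  obtain \<kappa> where \<kappa>: "\<nu> = \<mu> + \<kappa>"
    using assms(3) by (auto simp: mdvd_def)
  then have "mdeg \<kappa> = 0"
    using assms mdeg_W_set mdeg_add[of \<mu> \<kappa>] by fastforce
  then have "\<kappa> = 0"
    by (intro poly_mapping_eqI) (auto simp: mdeg_def in_keys_iff)
  with \<kappa> show ?thesis by simp
qed

lemma W_set_monomials: "W_set n m q s u \<subseteq> monomials (T_indets V s)"
  using W_set_nonminimal unfolding nonminimal_def by blast

lemma initial_ideal_rees_ideal:
  "initial_ideal (T_indets V s) (cw_T_less n m p q s) (rees_ideal V s u) =
    (Idl\<^bsub>poly_ring (T_indets V s)\<^esub> (mon ` W_set n m q s u) :: ((indet \<Rightarrow>\<^sub>0 nat) \<Rightarrow>\<^sub>0 'k::field) set)"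
proof -
  have sub: "{\<mu>. nonminimal \<mu>} \<subseteq> monomials (T_indets V s)"
    by (auto simp: nonminimal_def)
  have "initial_ideal (T_indets V s) (cw_T_less n m p q s) (rees_ideal V s u) =
    (Idl\<^bsub>poly_ring (T_indets V s)\<^esub> (mon ` {\<mu>. nonminimal \<mu>}) :: ((indet \<Rightarrow>\<^sub>0 nat) \<Rightarrow>\<^sub>0 'k) set)"
    unfolding initial_ideal_def initial_mons_rees_ideal nonminimal_def by simp
  also have "\<dots> = Idl\<^bsub>poly_ring (T_indets V s)\<^esub> (mon ` W_set n m q s u)"
    unfolding set_eq_subset Idl_mon_subset_iff[OF sub W_set_monomials]
      Idl_mon_subset_iff[OF W_set_monomials sub]
    using nonminimal_divisible W_set_nonminimal mdvd_refl by blast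
  finally show ?thesis .
qed

end

theorem theorem4p6:
  fixes n m s :: nat and p q :: "nat \<Rightarrow> nat"
    and u :: "nat \<Rightarrow> (indet \<Rightarrow>\<^sub>0 nat)"
    and V :: "indet set" and E :: "indet set set"
    and I J inJ :: "((indet \<Rightarrow>\<^sub>0 nat) \<Rightarrow>\<^sub>0 'k::field) set"
  assumes "n \<ge> 1" and "m \<ge> 1" and "\<forall>i\<in>{1..n}. p i \<ge> 1"
    and V: "V = cw_vertices n m p q" and E: "E = cw_edges n m p q"
    and I: "I = vertex_cover_ideal V E"
    and gens: "is_min_mon_gens V I (u ` {1..s})"
    and decreasing: "\<forall>r\<in>{1..s}. \<forall>r'\<in>{1..s}. r < r' \<longrightarrow>
                       lex_less (cw_vertex_list n m p q) (u r') (u r)"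
    and J: "J = rees_ideal V s u"
    and inJ: "inJ = initial_ideal (T_indets V s) (cw_T_less n m p q s) J"
  shows "(\<forall>W. is_min_mon_gens (T_indets V s) inJ W \<longleftrightarrow> W = W_set n m q s u) \<and>
         (\<exists>Q. Q \<subseteq> monomials (T_indets V s) \<and> (\<forall>\<mu>\<in>Q. mdeg \<mu> = 2) \<and>
              inJ = Idl\<^bsub>poly_ring (T_indets V s)\<^esub> (mon ` Q))"
proof -
  interpret cameron_walker n m p q
    by unfold_locales (use assms in auto)
  have "u ` {1..s} = cover_mon ` {C. minimal_vertex_cover V E C}"
    using gens unfolding I V by (simp add: is_min_mon_gens_vertex_cover_ideal_iff finite_V)
  then interpret cameron_walker_rees n m p q s u
    by unfold_locales (use decreasing V E in auto)
  have inJ_eq: "inJ = Idl\<^bsub>poly_ring (T_indets V s)\<^esub> (mon ` W_set n m q s u)"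
    unfolding inJ J V by (rule initial_ideal_rees_ideal)
  have "is_min_mon_gens (T_indets V s) inJ W \<longleftrightarrow> W = W_set n m q s u" for W
    unfolding inJ_eq V
    by (rule is_min_mon_gens_antichain_iff[OF W_set_monomials W_set_antichain])
  then show ?thesis
    using inJ_eq mdeg_W_set W_set_monomials V by blast
qed

end
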